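(* Let $A\in\mathbb{R}^{N\times N}$ be a symmetric and positive semi-definite matrix, let $n\ge 1$ be an integer, and let $\Sigma\subset\mathbb{C}$ be a compact set with $\Sigma\supseteq W(A)$. Then the following rational approximations to the matrix function $\operatorname{sinc}(A)$ hold with the stated error bounds. (i) Suppose $A$ is invertible and set $$P_n(A):=\left(L_n^{(-2n-1)}(iA)\right)^{-1}L_n^{(-2n-1)}(-iA),\qquad E_n(A):=-\frac{1}{2i}A^{-1}\left[P_n(A)-(P_n(A))^{-1}\right].$$ Then $$\|\operatorname{sinc}(A)-E_n(A)\|\le 2\left\|(2n+1)\left(\frac{n!}{(2n+1)!}\right)^2 z^{2n}\right\|_\Sigma .$$ (ii) Set $$F_n(A):=(-1)^n\binom{2n+1}{n}\,\mathcal{A}_n(2iA)\left(L_n^{(-2n-2)}(2iA)\right)^{-1}e^{iA}.$$ Then $$\|\operatorname{sinc}(A)-F_n(A)\|\le 2\left\|2^{2n}\left(\frac{n!}{(2n+1)!}\right)^2 z^{2n+1}\right\|_\Sigma .$$ Moreover, for the symmetrized version $$\tilde F_n(A):=\frac{(-1)^n}{2}\binom{2n+1}{n}\left[\mathcal{A}_n(iA)L_n^{(-2n-2)}(-iA)+\mathcal{A}_n(-iA)L_n^{(-2n-2)}(iA)\right]\left(L_n^{(-2n-2)}(iA)\,L_n^{(-2n-2)}(-iA)\right)^{-1},$$ one has $$\|\operatorname{sinc}(A)-\tilde F_n(A)\|\le 2\left\|\frac{n+1}{4n+6}\left(\frac{n!}{(2n+1)!}\right)^2 z^{2n+2}\right\|_\Sigma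 .$$
   Context: The unnormalized sinc function is $\operatorname{sinc} z=\frac{\sin z}{z}$ for $z\ne 0$ and $\operatorname{sinc} 0=1$ (an entire function); $\operatorname{sinc}(A)$ is the corresponding matrix function. $\|\cdot\|$ on matrices is the $2$-norm (spectral norm). For a set $\Sigma\subset\mathbb{C}$ and a function $f$ of the variable $z$, $\|f\|_\Sigma=\sup\{|f(s)|: s\in\Sigma\}$. The field of values of $A\in\mathbb{R}^{N\times N}$ is $W(A)=\{\mathbf{v}^HA\mathbf{v}:\mathbf{v}\in\mathbb{C}^N,\ \|\mathbf{v}\|=1\}$. $(w)_s=w(w+1)\cdots(w+s-1)$ is the Pochhammer symbol, with $(w)_0=1$. The generalized Laguerre polynomial of degree $n$ with parameter $\alpha$ is $$L_n^{(\alpha)}(x)=\binom{n+\alpha}{n}\,{}_1F_1(-n;\alpha+1;x)=\binom{n+\alpha}{n}\sum_{j=0}^n\frac{(-n)_j}{(\alpha+1)_j}\frac{x^j}{j!},$$ with the generalized binomial coefficient $\binom{m}{n}=\frac{m(m-1)\cdots(m-n+1)}{n!}$; it is used here with $\alpha=-2n-1$ and $\alpha=-2n-2$ (the sum is well defined in these cases). $\mathcal{A}_n$ is the polynomial of degree at most $n$ that is the numerator of the $[n/n]$-Padé approximant $\mathcal{A}_n(x)/\mathcal{B}_n(x)$ at $x=0$ of ${}_1F_1(1;2;-x)=\frac{1-e^{-x}}{x}$, where the denominator is normalized as $$\mathcal{B}_n(x)={}_1F_1(-n;-2n-1;x)=(-1)^n\binom{2n+1}{n}^{-1}L_n^{(-2n-2)}(x).$$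 Explicitly, $$\mathcal{A}_n(x)=x^n\frac{\Gamma(n+2)}{\Gamma(2n+2)}\sum_{k=0}^n\frac{(-n)_k(n+2)_k}{(2)_k\,k!}\;{}_3F_1\!\left(-n+k,\,n+2+k,\,1;\,1+k;\,-x^{-1}\right),$$ where ${}_3F_1(a,b,c;d;y)=\sum_{j\ge0}\frac{(a)_j(b)_j(c)_j}{(d)_j}\frac{y^j}{j!}$ (a terminating sum here, since $-n+k$ is a nonpositive integer). *)

theory Defs
  imports "HOL-Analysis.Analysis" "HOL-Computational_Algebra.Polynomial_FPS"
begin

section \<open>Complex square matrices\<close>

definition complexify :: "real^'n^'n \<Rightarrow> complex^'n^'n" where
  "complexify A = map_matrix complex_of_real A"

definition smult_matrix :: "complex \<Rightarrow> complex^'n^'n \<Rightarrow> complex^'n^'n"  (infixr \<open>*\<^sub>M\<close> 75) where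
  "c *\<^sub>M A = map_matrix ((*) c) A"

text \<open>The power \<open>^\<close> on \<^typ>\<open>complex^'n^'n\<close> would be componentwise.\<close>

definition matrix_power :: "complex^'n^'n \<Rightarrow> nat \<Rightarrow> complex^'n^'n" where
  "matrix_power A k = ((\<lambda>X. A ** X) ^^ k) (mat 1)"

definition poly_matrix :: "complex poly \<Rightarrow> complex^'n^'n \<Rightarrow> complex^'n^'n" where
  "poly_matrix p A = (\<Sum>j\<le>degree p. coeff p j *\<^sub>M matrix_power A j)"

text \<open>
  The matrix function \<open>f(A)\<close> for an entire function \<open>f\<close>, as the sum of the Taylor series of \<open>f\<close>
  at \<open>0\<close>. Only meant for entire \<open>f\<close>, for which the series converges at every matrix.
\<close>

definition matrix_fun :: "(complex \<Rightarrow> complex) \<Rightarrow> complex^'n^'n \<Rightarrow> complex^'n^'n" where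
  "matrix_fun f A = (\<Sum>k. ((deriv ^^ k) f 0 / fact k) *\<^sub>M matrix_power A k)"

definition csinc :: "complex \<Rightarrow> complex" where
  "csinc z = (if z = 0 then 1 else sin z / z)"

text \<open>
  The norm on \<^typ>\<open>complex^'n\<close> is the Euclidean one, so this is the matrix 2-norm. (The norm of the
  type \<^typ>\<open>complex^'n^'n\<close> is the Frobenius norm.)
\<close>

definition spectral_norm :: "complex^'n^'n \<Rightarrow> real" where
  "spectral_norm A = onorm (\<lambda>v. A *v v)"

definition field_of_values :: "complex^'n^'n \<Rightarrow> complex set" where
  "field_of_values A = {(\<Sum>i\<in>UNIV. cnj (v $ i) * (A *v v) $ i) | v. norm v = 1}"

definition sup_norm_on :: "complex set \<Rightarrow> (complex \<Rightarrow> complex) \<Rightarrow> real" where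
  "sup_norm_on S f = (SUP s\<in>S. cmod (f s))"


section \<open>Laguerre polynomials and the Pade numerator\<close>

text \<open>
  The terminating series \<open>1F1(-n; b; x)\<close>, summed over \<open>j \<le> n\<close> only, so that it makes sense also
  for integers \<open>b \<le> -n\<close>.
\<close>

definition kummer_poly :: "nat \<Rightarrow> complex \<Rightarrow> complex poly" where
  "kummer_poly n b =
     (\<Sum>j\<le>n. monom (pochhammer (- of_nat n) j / (pochhammer b j * fact j)) j)"

definition laguerre_poly :: "nat \<Rightarrow> complex \<Rightarrow> complex poly" where
  "laguerre_poly n a = smult ((of_nat n + a) gchoose n) (kummer_poly n (a + 1))"

text \<open>\<open>p/q\<close> is the \<open>[m/n]\<close>-Pade approximant of \<open>f\<close> at \<open>0\<close>.\<close>

definition is_pade_approximant ::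
    "nat \<Rightarrow> nat \<Rightarrow> complex fps \<Rightarrow> complex poly \<Rightarrow> complex poly \<Rightarrow> bool" where
  "is_pade_approximant m n f p q \<longleftrightarrow>
     degree p \<le> m \<and> degree q \<le> n \<and> coeff q 0 \<noteq> 0 \<and>
     (\<forall>k\<le>m + n. fps_nth (f - fps_of_poly p / fps_of_poly q) k = 0)"

definition pade_denom :: "nat \<Rightarrow> complex poly" where
  "pade_denom n = kummer_poly n (- of_nat (2*n + 1))"

text \<open>The series \<open>fps_hypergeo [1] [2] (-1)\<close> is \<open>1F1(1; 2; -x) = (1 - exp (-x)) / x\<close>.\<close>

definition pade_num :: "nat \<Rightarrow> complex poly" where
  "pade_num n =
     (THE p. is_pade_approximant n n (fps_hypergeo [1] [2] (-1)) p (pade_denom n))"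

lemma coeff_kummer_poly:
  "coeff (kummer_poly n b) j =
     (if j \<le> n then pochhammer (- of_nat n) j / (pochhammer b j * fact j) else 0)"
  by (simp add: kummer_poly_def coeff_sum)

lemma fps_nth_hypergeo_1_2:
  "fps_nth (fps_hypergeo [1] [2] (-1) :: complex fps) k = (-1) ^ k / fact (Suc k)"
proof -
  have "pochhammer (2::complex) k = fact (Suc k)"
    by (simp add: pochhammer_fact pochhammer_rec one_add_one)
  moreover have "pochhammer (1::complex) k = fact k"
    by (simp add: pochhammer_fact)
  ultimately show ?thesis
    by simp
qed

lemma pade_residual_eq_0:
  assumes "n < k" "k \<le> 2*n"
  shows "fps_nth (fps_of_poly (pade_denom n) * fps_hypergeo [1] [2] (-1)) k = 0"
proof -
  let ?c = "- of_nat (2*n + 1) :: complex"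
  let ?a = "- of_nat (Suc k) :: complex"
  let ?g = "fps_hypergeo [1] [2] (-1) :: complex fps"
  let ?t = "\<lambda>j. pochhammer ?a j * pochhammer (- of_nat n) j / (of_nat (fact j) * pochhammer ?c j)"
  have *: "coeff (pade_denom n) j * fps_nth ?g (k - j) = (-1) ^ k / fact (Suc k) * ?t j"
    if "j \<le> n" for j
  proof -
    have jk: "j \<le> k"
      using that assms by simp
    have "(fact (Suc k) :: complex) = fact (Suc k - j) * pochhammer (of_nat (Suc k) - of_nat j + 1) j"
      using pochhammer_product[of "Suc k - j" "Suc k" "1::complex"] jk
      by (simp add: pochhammer_fact[symmetric] of_nat_diff algebra_simps del: fact_Suc)
    hence "pochhammer ?a j = (-1) ^ j * (fact (Suc k) / fact (Suc k - j))"
      by (subst pochhammer_minus) (simp add: field_simps del: fact_Suc)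
    moreover have "(-1 :: complex) ^ k = (-1) ^ j * (-1) ^ (k - j)"
      using jk by (simp flip: power_add)
    moreover have "Suc (k - j) = Suc k - j"
      using jk by simp
    ultimately show ?thesis
      using that
      by (simp add: pade_denom_def coeff_kummer_poly fps_nth_hypergeo_1_2 mult_ac
          del: fact_Suc of_nat_Suc of_nat_add fps_hypergeo_nth)
  qed
  have "fps_nth (fps_of_poly (pade_denom n) * ?g) k =
        (\<Sum>j=0..k. coeff (pade_denom n) j * fps_nth ?g (k - j))"
    by (simp add: fps_mult_nth del: fps_hypergeo_nth)
  also have "\<dots> = (\<Sum>j=0..n. coeff (pade_denom n) j * fps_nth ?g (k - j))"
    using assms
    by (intro sum.mono_neutral_right)
       (auto simp: pade_denom_def coeff_kummer_poly simp del: fps_hypergeo_nth)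
  also have "\<dots> = (\<Sum>j=0..n. (-1) ^ k / fact (Suc k) * ?t j)"
    by (intro sum.cong refl *) auto
  also have "\<dots> = (-1) ^ k / fact (Suc k) * (\<Sum>j=0..n. ?t j)"
    by (simp only: sum_distrib_left)
  also have "(\<Sum>j=0..n. ?t j) = pochhammer (?c - ?a) n / pochhammer ?c n"
    by (intro Vandermonde_pochhammer ballI) (auto simp del: of_nat_Suc of_nat_add)
  also have "?c - ?a = - of_nat (2*n - k)"
    using assms by (simp add: of_nat_diff)
  also have "pochhammer (- of_nat (2*n - k) :: complex) n = 0"
    using assms by (simp add: pochhammer_of_nat_eq_0_iff del: of_nat_diff)
  finally show ?thesis by simp
qed

lemma is_pade_approximant_alt:
  assumes "coeff q 0 \<noteq> 0"
  shows "is_pade_approximant m n f p q \<longleftrightarrow> degree p \<le> m \<and> degree q \<le> n \<and>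
           (\<forall>k\<le>m + n. coeff p k = fps_nth (fps_of_poly q * f) k)"
proof -
  let ?q = "fps_of_poly q"
  have q0: "fps_nth ?q 0 \<noteq> 0" using assms by simp
  have inv: "inverse ?q * ?q = 1"
    using q0 by (rule inverse_mult_eq_1)
  have e1: "?q * (f - fps_of_poly p / ?q) = ?q * f - fps_of_poly p"
    using q0 inv by (simp add: fps_divide_unit algebra_simps)
  have e2: "f - fps_of_poly p / ?q = inverse ?q * (?q * f - fps_of_poly p)"
    unfolding e1[symmetric] mult.assoc[symmetric] inv by simp
  have low: "fps_nth (x * y) k = 0" if "\<forall>k\<le>N. fps_nth y k = 0" "k \<le> N"
    for x y :: "complex fps" and k N
    using that by (auto simp: fps_mult_nth intro!: sum.neutral)
  have "(\<forall>k\<le>m + n. fps_nth (f - fps_of_poly p / ?q) k = 0) \<longleftrightarrow>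
        (\<forall>k\<le>m + n. fps_nth (?q * f - fps_of_poly p) k = 0)"
    using low[of "m + n" "f - fps_of_poly p / ?q" _ ?q]
      low[of "m + n" "?q * f - fps_of_poly p" _ "inverse ?q"]
    unfolding e1 e2[symmetric] by blast
  thus ?thesis
    using assms by (auto simp: is_pade_approximant_def)
qed

text \<open>The numerator is well defined.\<close>

lemma ex1_pade_num:
  "\<exists>!p. is_pade_approximant n n (fps_hypergeo [1] [2] (-1)) p (pade_denom n)"
proof -
  let ?h = "fps_of_poly (pade_denom n) * fps_hypergeo [1] [2] (-1)"
  define p where "p = (\<Sum>k\<le>n. monom (fps_nth ?h k) k)"
  have p: "coeff p k = (if k \<le> n then fps_nth ?h k else 0)" for k
    by (simp add: p_def coeff_sum del: fps_hypergeo_nth)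
  have q0: "coeff (pade_denom n) 0 \<noteq> 0"
    by (simp add: pade_denom_def coeff_kummer_poly)
  have q: "degree (pade_denom n) \<le> n"
    by (rule degree_le) (simp add: pade_denom_def coeff_kummer_poly)
  have dp: "degree p \<le> n"
    by (rule degree_le) (simp add: p)
  show ?thesis
    unfolding is_pade_approximant_alt[OF q0]
  proof (rule ex1I[of _ p], intro conjI allI impI dp q)
    fix k assume "k \<le> n + n"
    thus "coeff p k = fps_nth ?h k"
      using pade_residual_eq_0[of n k] by (simp add: p del: fps_hypergeo_nth)
  next
    fix p' assume p': "degree p' \<le> n \<and> degree (pade_denom n) \<le> n \<and>
      (\<forall>k\<le>n + n. coeff p' k = fps_nth ?h k)"
    show "p' = p"
    proof (rule poly_eqI)
      fix k
      show "coeff p' k = coeff p k"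
        using p' by (cases "k \<le> n") (auto simp: p coeff_eq_0 simp del: fps_hypergeo_nth)
    qed
  qed
qed

lemma is_pade_approximant_pade_num:
  "is_pade_approximant n n (fps_hypergeo [1] [2] (-1)) (pade_num n) (pade_denom n)"
  unfolding pade_num_def by (rule theI'[OF ex1_pade_num])


section \<open>The approximations\<close>

definition P_approx :: "nat \<Rightarrow> complex^'n^'n \<Rightarrow> complex^'n^'n" where
  "P_approx n A =
     (let L = laguerre_poly n (- of_nat (2*n) - 1)
      in matrix_inv (poly_matrix L (\<i> *\<^sub>M A)) ** poly_matrix L ((- \<i>) *\<^sub>M A))"

definition E_approx :: "nat \<Rightarrow> complex^'n^'n \<Rightarrow> complex^'n^'n" where
  "E_approx n A =
     (- (1 / (2 * \<i>))) *\<^sub>M (matrix_inv A ** (P_approx n A - matrix_inv (P_approx n A)))"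

definition F_approx :: "nat \<Rightarrow> complex^'n^'n \<Rightarrow> complex^'n^'n" where
  "F_approx n A =
     (let L = laguerre_poly n (- of_nat (2*n) - 2)
      in ((-1) ^ n * of_nat ((2*n + 1) choose n)) *\<^sub>M
         (poly_matrix (pade_num n) ((2 * \<i>) *\<^sub>M A) **
          matrix_inv (poly_matrix L ((2 * \<i>) *\<^sub>M A)) **
          matrix_fun exp (\<i> *\<^sub>M A)))"

definition F_sym_approx :: "nat \<Rightarrow> complex^'n^'n \<Rightarrow> complex^'n^'n" where
  "F_sym_approx n A =
     (let L = laguerre_poly n (- of_nat (2*n) - 2)
      in ((-1) ^ n / 2 * of_nat ((2*n + 1) choose n)) *\<^sub>M
         ((poly_matrix (pade_num n) (\<i> *\<^sub>M A) ** poly_matrix L ((- \<i>) *\<^sub>M A) +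
           poly_matrix (pade_num n) ((- \<i>) *\<^sub>M A) ** poly_matrix L (\<i> *\<^sub>M A)) **
          matrix_inv (poly_matrix L (\<i> *\<^sub>M A) ** poly_matrix L ((- \<i>) *\<^sub>M A))))"

end

theory Submission
  imports Defs "HOL-Complex_Analysis.Complex_Analysis"
begin

text \<open>
  A real symmetric matrix is \<open>U diag(d) U\<^sup>T\<close> with \<open>U\<close> orthogonal, so every matrix in the theorem
  is \<open>U diag(g(d)) U\<^sup>T\<close> for a scalar function \<open>g\<close>, and the spectral norm of a difference is at
  most the largest error at an eigenvalue. The eigenvalues are nonnegative reals in the field of
  values, hence in \<open>\<Sigma>\<close>. It remains to bound the three scalar errors at a real point \<open>x \<ge> 0\<close>.

  All three approximations come from one identity. Integrating by parts until nothing is left of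
  the weight \<open>t\<^sup>a (1 - t)\<^sup>b\<close> in its Laplace transform over \<open>[0, 1]\<close> produces two polynomials, one of
  them multiplied by \<open>exp (-y)\<close>; both are Kummer polynomials, so
  the transform is the exact error of a Pade approximation (\<open>scaled_kummer_remainder\<close>). The case
  \<open>a = b = n\<close> is the diagonal Pade approximant of the exponential function, behind \<open>E\<close>. The case
  \<open>a = n, b = n + 1\<close> is, after division by \<open>y\<close>, the approximant of \<open>(1 - exp (-y)) / y\<close>, behind
  \<open>F\<close> and its symmetrization (\<open>pade_residual\<close>); that this is the numerator given by the power
  series definition is a Vandermonde sum (\<open>kummer_poly_exp_coeff\<close>).

  On the imaginary axis the exponential has modulus 1, so the integral is at most a Beta value,
  which yields the factorials in the bounds. The error also contains the reciprocal of the
  denominator \<open>B(ix)\<close>. This is harmless because \<open>|B(ix)|\<^sup>2\<close> is a polynomial in \<open>x\<^sup>2\<close> with nonnegative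
  coefficients and constant term 1 (\<open>norm_kummer_poly_imaginary_ge_1\<close>): \<open>B(y) B(-y)\<close> solves a linear
  differential system whose coefficient recurrence has two terms and a definite sign.

  The symmetrized approximation is the real part of \<open>A(ix) / B(ix)\<close>. To leading order the error is
  purely imaginary, which gains one power of \<open>x\<close>; what remains is the sum of the phases of the
  integral and of the denominator, at most \<open>x (n + 1) / (2 n + 3)\<close> and \<open>x n / (2 n + 1)\<close>
  (\<open>Re_pade_error_le\<close>). The second fraction is below the first by only a little, and their
  average is what is compared with \<open>2 (n + 1) / (4 n + 6)\<close>. For large \<open>x\<close> the bound without the
  gained power is already good enough.
\<close>


section \<open>The spectral theorem for real symmetric matrices\<close>

lemma symmetric_matrix_inner_commute:
  fixes A :: "real^'n^'n"
  assumes "transpose A = A"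
  shows "x \<bullet> (A *v y) = (A *v x) \<bullet> y"
  using assms by (metis dot_lmul_matrix matrix_vector_mult_def transpose_matrix_vector)

text \<open>
  The quadratic form attains its maximum on the unit sphere of the subspace at some \<open>v\<close>, with value
  \<open>q\<close>. Then \<open>q |x|\<^sup>2 - x \<bullet> (A x)\<close> is nonnegative on the subspace and vanishes at \<open>v\<close>; moving from \<open>v\<close>
  in the direction \<open>w = q v - A v\<close>, which lies in the subspace by invariance, changes it to first
  order by \<open>2 t |w|\<^sup>2\<close>, so \<open>w = 0\<close>.
\<close>

lemma symmetric_matrix_eigenvector_in_subspace:
  fixes A :: "real^'n^'n"
  assumes sym: "transpose A = A" and S: "subspace S" "z \<in> S" "z \<noteq> 0"
    and inv: "\<And>x. x \<in> S \<Longrightarrow> A *v x \<in> S"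
  obtains v c where "v \<in> S" "norm v = 1" "A *v v = c *\<^sub>R v"
proof -
  let ?q = "\<lambda>x. x \<bullet> (A *v x)"
  have "compact (S \<inter> sphere 0 1)"
    using S by (intro closed_Int_compact closed_subspace) auto
  moreover have "(1 / norm z) *\<^sub>R z \<in> S \<inter> sphere 0 1"
    using S by (auto intro: subspace_scale)
  moreover have "continuous_on (S \<inter> sphere 0 1) ?q"
    by (intro continuous_intros linear_continuous_on_compose[OF _ matrix_vector_mul_linear])
  ultimately obtain v where v: "v \<in> S \<inter> sphere 0 1"
    and max: "\<And>x. x \<in> S \<inter> sphere 0 1 \<Longrightarrow> ?q x \<le> ?q v"
    using continuous_attains_sup[of "S \<inter> sphere 0 1" ?q] by blast
  have v1: "v \<in> S" "norm v = 1" "v \<bullet> v = 1"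
    using v by (auto simp: norm_eq_1)
  have le: "?q x \<le> ?q v * (x \<bullet> x)" if "x \<in> S" for x
  proof (cases "x = 0")
    case False
    have "?q ((1 / norm x) *\<^sub>R x) \<le> ?q v"
      using that S False by (intro max) (auto intro: subspace_scale)
    thus ?thesis
      using False
      by (simp add: matrix_vector_mult_scaleR field_simps power2_norm_eq_inner[symmetric] power2_eq_square)
  qed auto
  define w where "w = ?q v *\<^sub>R v - A *v v"
  have wS: "w \<in> S"
    unfolding w_def using v1 S inv by (intro subspace_diff subspace_scale) auto
  define h where "h = ?q v * (w \<bullet> w) - ?q w"
  have *: "0 \<le> 2 * t * (w \<bullet> w) + t^2 * h" for t :: real
  proof -
    have "v + t *\<^sub>R w \<in> S"
      using v1 wS S by (intro subspace_add subspace_scale) auto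
    from le[OF this] have "?q (v + t *\<^sub>R w) \<le> ?q v * ((v + t *\<^sub>R w) \<bullet> (v + t *\<^sub>R w))" .
    moreover have "?q (v + t *\<^sub>R w) = ?q v + 2 * t * (w \<bullet> (A *v v)) + t^2 * ?q w"
      using symmetric_matrix_inner_commute[OF sym, of v w]
      by (simp add: matrix_vector_right_distrib matrix_vector_mult_scaleR inner_add
          power2_eq_square algebra_simps inner_commute)
    moreover have "(v + t *\<^sub>R w) \<bullet> (v + t *\<^sub>R w) = 1 + 2 * t * (w \<bullet> v) + t^2 * (w \<bullet> w)"
      using v1 by (simp add: inner_add power2_eq_square algebra_simps inner_commute)
    moreover have "w \<bullet> w = ?q v * (w \<bullet> v) - w \<bullet> (A *v v)"
      by (subst (2) w_def) (simp add: inner_diff_right)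
    ultimately have "?q v + 2 * t * (w \<bullet> (A *v v)) + t^2 * ?q w \<le> ?q v * (1 + 2 * t * (w \<bullet> v) + t^2 * (w \<bullet> w))"
      "w \<bullet> w = ?q v * (w \<bullet> v) - w \<bullet> (A *v v)"
      by simp_all
    thus ?thesis
      unfolding h_def by (simp only: ring_distribs) (simp add: algebra_simps)
  qed
  have "w \<bullet> w = 0"
  proof (rule ccontr)
    assume "w \<bullet> w \<noteq> 0"
    hence pos: "w \<bullet> w > 0" by simp
    \<comment> \<open>A negative step so short that the linear term outweighs the quadratic one.\<close>
    define t where "t = - (w \<bullet> w) / (\<bar>h\<bar> + 1)"
    have t: "t < 0" "t * (\<bar>h\<bar> + 1) = - (w \<bullet> w)"
      using pos by (auto simp: t_def field_simps)
    have "0 \<le> t * (2 * (w \<bullet> w) + t * h)"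
      using *[of t] by (simp add: power2_eq_square algebra_simps)
    hence "2 * (w \<bullet> w) + t * h \<le> 0"
      using t by (simp add: zero_le_mult_iff)
    moreover have "t * h \<ge> t * (\<bar>h\<bar> + 1)"
      using t by (intro mult_left_mono_neg) auto
    ultimately show False
      using t pos by simp
  qed
  hence "A *v v = ?q v *\<^sub>R v"
    by (simp add: w_def)
  thus ?thesis
    using that v1 by blast
qed

text \<open>
  The orthogonal complement of a set of eigenvectors is invariant under a symmetric matrix, so as
  long as it is nonzero it contains a further eigenvector.
\<close>

lemma symmetric_matrix_orthonormal_eigenvectors:
  fixes A :: "real^'n^'n"
  assumes sym: "transpose A = A" and "k \<le> CARD('n)"
  shows "\<exists>B. finite B \<and> card B = k \<and> pairwise orthogonal B \<and>
             (\<forall>b\<in>B. norm b = 1 \<and> (\<exists>c. A *v b = c *\<^sub>R b))"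
  using assms(2)
proof (induction k)
  case 0
  show ?case by (intro exI[of _ "{}"]) auto
next
  case (Suc k)
  then obtain B where B: "finite B" "card B = k" "pairwise orthogonal B"
    "\<And>b. b \<in> B \<Longrightarrow> norm b = 1" "\<And>b. b \<in> B \<Longrightarrow> \<exists>c. A *v b = c *\<^sub>R b"
    by auto
  define S where "S = {x. \<forall>b\<in>B. orthogonal b x}"
  have "dim B < DIM(real^'n)"
    using dim_le_card'[OF B(1)] B(2) Suc.prems by simp
  then obtain z where z: "z \<noteq> 0" "\<And>y. y \<in> span B \<Longrightarrow> orthogonal z y"
    using orthogonal_to_subspace_exists by metis
  have "subspace S"
    unfolding S_def by (rule subspace_orthogonal_to_vectors)
  moreover have "z \<in> S"
    unfolding S_def using z(2) by (auto simp: orthogonal_commute span_base)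
  moreover have "A *v x \<in> S" if "x \<in> S" for x
    unfolding S_def
  proof safe
    fix b assume "b \<in> B"
    then obtain c where "A *v b = c *\<^sub>R b" using B by blast
    thus "orthogonal b (A *v x)"
      using that \<open>b \<in> B\<close> by (simp add: S_def orthogonal_def symmetric_matrix_inner_commute[OF sym])
  qed
  ultimately obtain v c where v: "v \<in> S" "norm v = 1" "A *v v = c *\<^sub>R v"
    using symmetric_matrix_eigenvector_in_subspace[OF sym _ _ z(1)] by metis
  have "v \<notin> B"
    using v by (auto simp: S_def orthogonal_def)
  hence "card (insert v B) = Suc k" "finite (insert v B)"
    using B by auto
  moreover have "pairwise orthogonal (insert v B)"
    using B v by (auto simp: pairwise_insert S_def orthogonal_commute)
  moreover have "\<forall>b\<in>insert v B. norm b = 1 \<and> (\<exists>c. A *v b = c *\<^sub>R b)"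
    using B v by auto
  ultimately show ?case by blast
qed

theorem symmetric_matrix_orthogonally_diagonalizable:
  fixes A :: "real^'n^'n"
  assumes sym: "transpose A = A"
  obtains U d where "orthogonal_matrix U" "\<And>j. A *v column j U = d j *\<^sub>R column j U"
proof -
  obtain B where B: "finite B" "card B = CARD('n)" "pairwise orthogonal B"
    "\<And>b. b \<in> B \<Longrightarrow> norm b = 1" "\<And>b. b \<in> B \<Longrightarrow> \<exists>c. A *v b = c *\<^sub>R b"
    using symmetric_matrix_orthonormal_eigenvectors[OF sym order.refl] by blast
  then obtain f where f: "bij_betw f (UNIV :: 'n set) B"
    using finite_same_card_bij[of "UNIV :: 'n set" B] by auto
  define U where "U = (\<chi> i j. f j $ i)"
  have col: "column j U = f j" for j
    by (simp add: U_def column_def)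
  have fB: "f j \<in> B" for j
    using f by (auto simp: bij_betw_def)
  have "orthogonal (f i) (f j)" if "i \<noteq> j" for i j
    using that B(3) fB f unfolding pairwise_def bij_betw_def inj_on_def by (metis UNIV_I)
  hence "orthogonal_matrix U"
    using B fB by (simp add: orthogonal_matrix_orthonormal_columns col)
  moreover have "\<exists>d. \<forall>j. A *v column j U = d j *\<^sub>R column j U"
    using B(5)[OF fB] unfolding col by metis
  ultimately show ?thesis
    using that by blast
qed


section \<open>Matrices diagonal in a fixed real orthonormal basis\<close>

definition diag_matrix :: "('n \<Rightarrow> complex) \<Rightarrow> complex^'n^'n" where
  "diag_matrix d = (\<chi> i j. if i = j then d i else 0)"

text \<open>
  For orthogonal \<open>U\<close> these matrices form a commutative algebra on which all operations used in the
  approximations act entrywise on the argument \<open>d\<close>.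
\<close>

definition conj_diag :: "real^'n^'n \<Rightarrow> ('n \<Rightarrow> complex) \<Rightarrow> complex^'n^'n" where
  "conj_diag U d = complexify U ** diag_matrix d ** complexify (transpose U)"

lemma complexify_nth [simp]: "complexify A $ i $ j = complex_of_real (A $ i $ j)"
  by (simp add: complexify_def map_matrix_def)

lemma smult_matrix_nth [simp]: "(c *\<^sub>M A) $ i $ j = c * A $ i $ j"
  by (simp add: smult_matrix_def map_matrix_def)

lemma complexify_mult: "complexify (A ** B) = complexify A ** complexify B"
  by (simp add: vec_eq_iff matrix_matrix_mult_def)

lemma complexify_mat_1 [simp]: "complexify (mat 1) = mat 1"
  by (simp add: vec_eq_iff mat_def)

lemma complexify_orthogonal:
  assumes "orthogonal_matrix U"
  shows "complexify (transpose U) ** complexify U = mat 1"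
    "complexify U ** complexify (transpose U) = mat 1"
  using assms by (simp_all flip: complexify_mult add: orthogonal_matrix_def)

lemma conj_diag_nth:
  "conj_diag U d $ i $ k = (\<Sum>j\<in>UNIV. of_real (U $ i $ j) * d j * of_real (U $ k $ j))"
  by (simp add: conj_diag_def diag_matrix_def matrix_matrix_mult_def transpose_def
      if_distrib cong: if_cong)

lemma conj_diag_add: "conj_diag U d + conj_diag U e = conj_diag U (\<lambda>j. d j + e j)"
  by (simp add: vec_eq_iff conj_diag_nth sum.distrib algebra_simps)

lemma conj_diag_diff: "conj_diag U d - conj_diag U e = conj_diag U (\<lambda>j. d j - e j)"
  by (simp add: vec_eq_iff conj_diag_nth sum_subtractf algebra_simps)

lemma conj_diag_smult: "c *\<^sub>M conj_diag U d = conj_diag U (\<lambda>j. c * d j)"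
  by (simp add: vec_eq_iff conj_diag_nth sum_distrib_left algebra_simps)

lemma conj_diag_sum: "(\<Sum>k\<in>K. conj_diag U (d k)) = conj_diag U (\<lambda>j. \<Sum>k\<in>K. d k j)"
  by (induction K rule: infinite_finite_induct)
     (simp_all add: conj_diag_add vec_eq_iff conj_diag_nth sum.distrib algebra_simps)

lemma conj_diag_sums:
  assumes "\<And>j. (\<lambda>k. d k j) sums e j"
  shows "(\<lambda>k. conj_diag U (d k)) sums conj_diag U e"
proof -
  have "(\<lambda>N. \<Sum>k<N. d k j) \<longlonglongrightarrow> e j" for j
    using assms unfolding sums_def .
  thus ?thesis
    unfolding sums_def conj_diag_sum
    by (intro vec_tendstoI) (auto simp: conj_diag_nth intro!: tendsto_intros)
qed

context
  fixes U :: "real^'n^'n"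
  assumes U: "orthogonal_matrix U"
begin

lemma conj_diag_mult: "conj_diag U d ** conj_diag U e = conj_diag U (\<lambda>j. d j * e j)"
proof -
  have "diag_matrix d ** diag_matrix e = diag_matrix (\<lambda>j. d j * e j)"
    by (simp add: vec_eq_iff diag_matrix_def matrix_matrix_mult_def mult_delta_left)
  moreover have "conj_diag U d ** conj_diag U e =
      complexify U ** (diag_matrix d ** ((complexify (transpose U) ** complexify U) ** diag_matrix e)) ** complexify (transpose U)"
    by (simp only: conj_diag_def matrix_mul_assoc)
  ultimately show ?thesis
    by (simp add: complexify_orthogonal[OF U] conj_diag_def)
qed

lemma conj_diag_1: "conj_diag U (\<lambda>_. 1) = mat 1"
proof -
  have "diag_matrix (\<lambda>_. 1) = (mat 1 :: complex^'n^'n)"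
    by (simp add: diag_matrix_def mat_def)
  thus ?thesis
    by (simp add: conj_diag_def complexify_orthogonal[OF U])
qed

lemma matrix_power_conj_diag: "matrix_power (conj_diag U d) k = conj_diag U (\<lambda>j. d j ^ k)"
  by (induction k) (simp_all add: matrix_power_def conj_diag_1 conj_diag_mult)

lemma poly_matrix_conj_diag: "poly_matrix p (conj_diag U d) = conj_diag U (\<lambda>j. poly p (d j))"
  by (simp add: poly_matrix_def matrix_power_conj_diag conj_diag_smult conj_diag_sum poly_altdef)

text \<open>
  The Taylor series of an entire function converges at each diagonal entry, hence entrywise for the
  matrices.
\<close>

lemma matrix_fun_conj_diag:
  assumes "f holomorphic_on UNIV"
  shows "matrix_fun f (conj_diag U d) = conj_diag U (\<lambda>j. f (d j))"
proof -
  have "(\<lambda>k. (deriv ^^ k) f 0 / fact k * d j ^ k) sums f (d j)" for j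
    using holomorphic_power_series[of f 0 "cmod (d j) + 1" "d j"] assms
    by (auto intro: holomorphic_on_subset)
  hence "(\<lambda>k. conj_diag U (\<lambda>j. (deriv ^^ k) f 0 / fact k * d j ^ k)) sums conj_diag U (\<lambda>j. f (d j))"
    by (rule conj_diag_sums)
  thus ?thesis
    by (simp add: matrix_fun_def matrix_power_conj_diag conj_diag_smult sums_iff)
qed

lemma conj_diag_inverse:
  assumes "\<And>j. d j \<noteq> 0"
  shows "invertible (conj_diag U d)" "matrix_inv (conj_diag U d) = conj_diag U (\<lambda>j. inverse (d j))"
proof -
  let ?B = "conj_diag U (\<lambda>j. inverse (d j))"
  have eq: "conj_diag U d ** ?B = mat 1" "?B ** conj_diag U d = mat 1"
    by (simp_all add: conj_diag_mult assms conj_diag_1)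
  thus inv: "invertible (conj_diag U d)"
    unfolding invertible_def by blast
  have *: "conj_diag U d ** matrix_inv (conj_diag U d) = mat 1 \<and>
        matrix_inv (conj_diag U d) ** conj_diag U d = mat 1"
    using inv unfolding invertible_def matrix_inv_def by (rule someI_ex)
  have "matrix_inv (conj_diag U d) = (?B ** conj_diag U d) ** matrix_inv (conj_diag U d)"
    by (simp add: eq)
  also have "\<dots> = ?B"
    using * by (simp flip: matrix_mul_assoc)
  finally show "matrix_inv (conj_diag U d) = ?B" .
qed

text \<open>
  A real matrix acts separately on the real and the imaginary part of a complex vector.
\<close>

lemma norm_complexify_orthogonal: "norm (complexify U *v v) = norm v"
proof -
  have norm_eq: "(norm w)\<^sup>2 = (norm (\<chi> i. Re (w $ i)))\<^sup>2 + (norm (\<chi> i. Im (w $ i)))\<^sup>2"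
    for w :: "complex^'n"
    by (simp add: norm_vec_def L2_set_def sum_nonneg cmod_power2 sum.distrib)
  have "orthogonal_transformation ((*v) U)"
    using U by (simp add: orthogonal_transformation_matrix)
  hence "norm (U *v x) = norm x" for x
    by (simp add: orthogonal_transformation)
  moreover have "(\<chi> i. Re ((complexify U *v v) $ i)) = U *v (\<chi> i. Re (v $ i))"
    "(\<chi> i. Im ((complexify U *v v) $ i)) = U *v (\<chi> i. Im (v $ i))"
    by (simp_all add: vec_eq_iff matrix_vector_mult_def)
  ultimately have "(norm (complexify U *v v))\<^sup>2 = (norm v)\<^sup>2"
    by (subst (1 2) norm_eq) simp
  thus ?thesis by simp
qed

end

lemma spectral_norm_conj_diag_le:
  fixes U :: "real^'n^'n"
  assumes U: "orthogonal_matrix U" and "\<And>j. cmod (d j) \<le> c"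
  shows "spectral_norm (conj_diag U d) \<le> c"
  unfolding spectral_norm_def
proof (rule onorm_bound)
  show c: "0 \<le> c"
    using assms(2) norm_ge_zero order_trans by blast
  fix v :: "complex^'n"
  define w where "w = complexify (transpose U) *v v"
  have "norm (conj_diag U d *v v) = norm (complexify U *v (diag_matrix d *v w))"
    by (simp add: conj_diag_def w_def matrix_vector_mul_assoc matrix_mul_assoc)
  also have "\<dots> = norm (diag_matrix d *v w)"
    by (rule norm_complexify_orthogonal[OF U])
  also have "diag_matrix d *v w = (\<chi> j. d j * w $ j)"
    by (simp add: vec_eq_iff diag_matrix_def matrix_vector_mult_def mult_delta_left)
  also have "norm \<dots> \<le> norm (c *\<^sub>R w)"
    unfolding norm_vec_def
    by (intro L2_set_mono) (use assms(2) in \<open>auto simp: norm_mult intro!: mult_mono intro: order.trans[OF _ abs_ge_self]\<close>)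
  also have "\<dots> = c * norm v"
    using norm_complexify_orthogonal[of "transpose U" v] U c
    unfolding w_def by simp
  finally show "norm (conj_diag U d *v v) \<le> c * norm v" .
qed

lemma eigenvalue_in_field_of_values:
  fixes A :: "real^'n^'n"
  assumes "A *v u = c *\<^sub>R u" "norm u = 1"
  shows "complex_of_real c \<in> field_of_values (complexify A)"
proof -
  define v where "v = (\<chi> i. complex_of_real (u $ i))"
  have eig: "(complexify A *v v) $ i = of_real (c * u $ i)" for i
    using assms(1) unfolding vec_eq_iff v_def matrix_vector_mult_def
    by (simp flip: of_real_mult of_real_sum)
  have "u \<bullet> u = 1"
    using assms(2) by (simp add: norm_eq_1)
  moreover have "(\<Sum>i\<in>UNIV. cnj (v $ i) * (complexify A *v v) $ i) = complex_of_real (c * (u \<bullet> u))"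
    unfolding eig inner_vec_def
    by (simp add: v_def sum_distrib_left mult_ac)
  moreover have "norm v = 1"
    using assms(2) by (simp add: v_def norm_vec_def)
  ultimately show ?thesis
    unfolding field_of_values_def by force
qed

lemma complexify_eq_conj_diag:
  fixes A :: "real^'n^'n"
  assumes U: "orthogonal_matrix U" and eig: "\<And>j. A *v column j U = d j *\<^sub>R column j U"
  shows "complexify A = conj_diag U (\<lambda>j. of_real (d j))"
proof -
  have "complexify A ** complexify U = complexify U ** diag_matrix (\<lambda>j. of_real (d j))"
    unfolding complexify_mult[symmetric]
    using eig
    by (simp add: vec_eq_iff diag_matrix_def matrix_matrix_mult_def matrix_vector_mult_def
        column_def if_distrib mult_ac cong: if_cong)
  hence "complexify A ** (complexify U ** complexify (transpose U)) = conj_diag U (\<lambda>j. of_real (d j))"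
    by (simp add: conj_diag_def matrix_mul_assoc)
  thus ?thesis
    by (simp add: complexify_orthogonal[OF U])
qed

lemma csinc_holomorphic: "csinc holomorphic_on UNIV"
proof -
  have "(\<lambda>z. if z = 0 then deriv sin 0 else (sin z - sin 0) / (z - 0)) holomorphic_on (UNIV :: complex set)"
    by (rule pole_lemma) (auto intro: holomorphic_intros)
  moreover have "deriv sin (0::complex) = 1"
    by (rule DERIV_imp_deriv) (auto intro!: derivative_eq_intros)
  hence "csinc = (\<lambda>z. if z = 0 then deriv sin 0 else (sin z - sin 0) / (z - 0))"
    by (simp add: csinc_def fun_eq_iff)
  ultimately show ?thesis
    by simp
qed

lemma norm_le_sup_norm_on:
  assumes "compact S" "continuous_on S f" "s \<in> S"
  shows "cmod (f s) \<le> sup_norm_on S f"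
proof -
  have "compact ((\<lambda>s. cmod (f s)) ` S)"
    using assms by (intro compact_continuous_image continuous_intros)
  hence "bdd_above ((\<lambda>s. cmod (f s)) ` S)"
    by (intro bounded_imp_bdd_above compact_imp_bounded)
  thus ?thesis
    unfolding sup_norm_on_def by (rule cSUP_upper[OF assms(3)])
qed


section \<open>Beta integrals as remainders of rational approximations to the exponential\<close>

text \<open>
  This is \<open>(a + b)! 1F1(-a; -a-b; y)\<close>. The factorial makes the coefficients integers and the
  recurrence below free of division.
\<close>

definition scaled_kummer :: "nat \<Rightarrow> nat \<Rightarrow> complex \<Rightarrow> complex" where
  "scaled_kummer a b y = (\<Sum>j\<le>a. of_nat ((a choose j) * fact (a + b - j)) * y ^ j)"

text \<open>
  The polynomial counterpart of integration by parts: it has the same shape as the recurrence of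
  \<open>beta_laplace\<close>, including the boundary term. Subtracting from 0 is harmless, since
  those terms carry the factor 0.
\<close>

lemma scaled_kummer_rec:
  "scaled_kummer a b y = of_nat a * scaled_kummer (a - 1) b y + of_nat b * scaled_kummer a (b - 1) y + (if b = 0 then y ^ a else 0)"
proof -
  have coeff: "(a choose j) * fact (a + b - j) =
      a * ((a - 1 choose j) * fact (a - 1 + b - j)) + b * ((a choose j) * fact (a + (b - 1) - j)) +
      of_bool (b = 0 \<and> j = a)" if "j \<le> a" for j
  proof (cases "j = a")
    case True
    thus ?thesis
      by (cases a; cases b) (simp_all add: binomial_eq_0)
  next
    case False
    with that have j: "j < a" by simp
    have "(a choose j) * fact (a + b - j) = (a choose j) * ((a - j + b) * fact (a - 1 + b - j))"
    proof -
      have "a + b - j = Suc (a - 1 + b - j)" "a - j + b = Suc (a - 1 + b - j)" using j by auto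
      thus ?thesis by (metis fact_Suc of_nat_id)
    qed
    also have "\<dots> = ((a - j) * (a choose j)) * fact (a - 1 + b - j) + b * ((a choose j) * fact (a - 1 + b - j))"
      by (simp add: algebra_simps)
    also have "(a - j) * (a choose j) = a * (a - 1 choose j)"
      by (rule binomial_absorb_comp)
    also have "b * ((a choose j) * fact (a - 1 + b - j)) = b * ((a choose j) * fact (a + (b - 1) - j))"
      using j by (cases b) auto
    finally show ?thesis
      using j by simp
  qed
  have shorter: "scaled_kummer (a - 1) b y = (\<Sum>j\<le>a. of_nat ((a - 1 choose j) * fact (a - 1 + b - j)) * y ^ j)"
    if "a \<noteq> 0"
    using that unfolding scaled_kummer_def by (cases a) (auto simp: binomial_eq_0)
  have delta: "(\<Sum>j\<le>a. of_bool (b = 0 \<and> j = a) * y ^ j) = (if b = 0 then y ^ a else 0)"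
    by (cases "b = 0") (simp_all add: of_bool_def mult_delta_left)
  have "scaled_kummer a b y = (\<Sum>j\<le>a. of_nat a * (of_nat ((a - 1 choose j) * fact (a - 1 + b - j)) * y ^ j) +
      of_nat b * (of_nat ((a choose j) * fact (a + (b - 1) - j)) * y ^ j) +
      of_bool (b = 0 \<and> j = a) * y ^ j)"
    unfolding scaled_kummer_def
    by (intro sum.cong refl, subst coeff) (simp_all only: of_nat_add of_nat_mult of_nat_of_bool ring_distribs mult.assoc atMost_iff)
  also have "\<dots> = of_nat a * (\<Sum>j\<le>a. of_nat ((a - 1 choose j) * fact (a - 1 + b - j)) * y ^ j) +
      of_nat b * scaled_kummer a (b - 1) y + (if b = 0 then y ^ a else 0)"
    by (simp only: sum.distrib sum_distrib_left[symmetric] scaled_kummer_def delta)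
  finally show ?thesis
    using shorter by (cases "a = 0") auto
qed

lemma cnj_scaled_kummer: "cnj (scaled_kummer a b y) = scaled_kummer a b (cnj y)"
  by (simp add: scaled_kummer_def)

text \<open>
  The Laplace transform of the weight of the Beta integral, a multiple of
  \<open>1F1(a+1; a+b+2; -y)\<close>.
\<close>

definition beta_laplace :: "nat \<Rightarrow> nat \<Rightarrow> complex \<Rightarrow> complex" where
  "beta_laplace a b y =
     integral {0..1} (\<lambda>t. of_real t ^ a * (1 - of_real t) ^ b * exp (- (of_real t * y)))"

lemma beta_laplace_integrable:
  "(\<lambda>t. of_real t ^ a * (1 - of_real t) ^ b * exp (- (of_real t * y)) :: complex) integrable_on {0..1}"
  by (intro integrable_continuous_real continuous_intros)

lemma beta_laplace_parts:
  "y * beta_laplace a b y = of_nat a * beta_laplace (a - 1) b y - of_nat b * beta_laplace a (b - 1) y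
     + (if a = 0 then 1 else 0) - (if b = 0 then exp (- y) else 0)"
proof -
  define F where "F = (\<lambda>z. z ^ a * (1 - z) ^ b * exp (- (z * y)))"
  define G where "G = (\<lambda>a b t. of_real t ^ a * (1 - of_real t) ^ b * exp (- (of_real t * y)))"
  have G: "(G a b has_integral beta_laplace a b y) {0..1}" for a b
    unfolding G_def beta_laplace_def by (rule integrable_integral[OF beta_laplace_integrable])
  have "((\<lambda>t. F (of_real t)) has_vector_derivative
      of_nat a * G (a - 1) b t - of_nat b * G a (b - 1) t - y * G a b t) (at t within {0..1})" for t
    unfolding F_def G_def
    by (rule has_vector_derivative_at_within, rule has_vector_derivative_real_field)
       (auto intro!: derivative_eq_intros simp: algebra_simps)
  hence "((\<lambda>t. of_nat a * G (a - 1) b t - of_nat b * G a (b - 1) t - y * G a b t) has_integral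
      F (of_real 1) - F (of_real 0)) {0..1}"
    by (intro fundamental_theorem_of_calculus) auto
  moreover have "((\<lambda>t. of_nat a * G (a - 1) b t - of_nat b * G a (b - 1) t - y * G a b t) has_integral
      of_nat a * beta_laplace (a - 1) b y - of_nat b * beta_laplace a (b - 1) y - y * beta_laplace a b y) {0..1}"
    by (intro has_integral_diff has_integral_mult_right G)
  ultimately have "F (of_real 1) - F (of_real 0) =
      of_nat a * beta_laplace (a - 1) b y - of_nat b * beta_laplace a (b - 1) y - y * beta_laplace a b y"
    by (rule has_integral_unique)
  thus ?thesis
    by (simp add: F_def power_0_left algebra_simps split: if_splits)
qed

text \<open>
  Both sides satisfy the same recurrence in \<open>a\<close> and \<open>b\<close>: on the right it is integration by parts, on
  the left it is the recurrence of the two polynomials. With \<open>b\<close> replaced by \<open>m - a\<close>, this is the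
  error of the Pade approximation of type \<open>[m-a/a]\<close> to \<open>exp (-y)\<close>, cleared of its denominator.
\<close>

lemma scaled_kummer_remainder:
  "scaled_kummer b a (- y) - exp (- y) * scaled_kummer a b y = (-1) ^ b * y ^ (a + b + 1) * beta_laplace a b y"
proof (induction "a + b" arbitrary: a b rule: less_induct)
  case less
  have 1: "of_nat a * ((-1) ^ b * y ^ (a + b) * beta_laplace (a - 1) b y) =
      of_nat a * (scaled_kummer b (a - 1) (- y) - exp (- y) * scaled_kummer (a - 1) b y)"
    using less[of "a - 1" b] by (cases a) auto
  have 2: "of_nat b * (- ((-1) ^ b * y ^ (a + b) * beta_laplace a (b - 1) y)) =
      of_nat b * (scaled_kummer (b - 1) a (- y) - exp (- y) * scaled_kummer a (b - 1) y)"
    using less[of a "b - 1"] by (cases b) auto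
  have "(-1) ^ b * y ^ (a + b + 1) * beta_laplace a b y =
      (-1) ^ b * y ^ (a + b) * (y * beta_laplace a b y)"
    by simp
  also have "\<dots> = of_nat a * ((-1) ^ b * y ^ (a + b) * beta_laplace (a - 1) b y) +
      of_nat b * (- ((-1) ^ b * y ^ (a + b) * beta_laplace a (b - 1) y)) +
      (if a = 0 then (- y) ^ b else 0) - exp (- y) * (if b = 0 then y ^ a else 0)"
    by (subst beta_laplace_parts) (simp add: algebra_simps power_minus[of y])
  also have "\<dots> = scaled_kummer b a (- y) - exp (- y) * scaled_kummer a b y"
    unfolding 1 2 scaled_kummer_rec[of b a "- y"] scaled_kummer_rec[of a b y] by (simp only: ring_distribs) simp
  finally show ?case by simp
qed

text \<open>
  Induction on \<open>b\<close>: integrating the derivative of \<open>t\<^sup>a\<^sup>+\<^sup>1 (1 - t)\<^sup>b\<^sup>+\<^sup>1\<close>, which vanishes at both ends,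
  exchanges a factor \<open>1 - t\<close> for a factor \<open>t\<close>.
\<close>

lemma beta_integral:
  "((\<lambda>t. t ^ a * (1 - t) ^ b) has_integral (fact a * fact b / fact (a + b + 1))) {0..1::real}"
proof (induction b arbitrary: a)
  case 0
  have "((\<lambda>t. t ^ a) has_integral (1 ^ Suc a / real (Suc a) - 0 ^ Suc a / real (Suc a))) {0..1::real}"
    using DERIV_cdivide[OF DERIV_pow[of "Suc a"], where c = "real (Suc a)"]
    by (intro fundamental_theorem_of_calculus)
       (simp_all flip: has_real_derivative_iff_has_vector_derivative del: of_nat_Suc power_Suc)
  thus ?case
    by (simp add: field_simps del: of_nat_Suc)
next
  case (Suc b)
  have "((\<lambda>t. real (Suc a) * (t ^ a * (1 - t) ^ Suc b) - real (Suc b) * (t ^ Suc a * (1 - t) ^ b))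
      has_integral 1 ^ Suc a * (1 - 1) ^ Suc b - 0 ^ Suc a * (1 - 0) ^ Suc b) {0..1::real}"
  proof (intro fundamental_theorem_of_calculus)
    fix t :: real
    have "((\<lambda>t. 1 - t) has_real_derivative - 1) (at t within {0..1})"
      by (auto intro!: derivative_eq_intros)
    from DERIV_mult[OF DERIV_pow[of "Suc a"] DERIV_power[OF this, of "Suc b"]]
    have "((\<lambda>t. t ^ Suc a * (1 - t) ^ Suc b) has_real_derivative
        real (Suc a) * (t ^ a * (1 - t) ^ Suc b) - real (Suc b) * (t ^ Suc a * (1 - t) ^ b)) (at t within {0..1})"
      by (rule DERIV_cong) (simp add: mult_ac del: power_Suc of_nat_Suc)
    thus "((\<lambda>t. t ^ Suc a * (1 - t) ^ Suc b) has_vector_derivative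
        real (Suc a) * (t ^ a * (1 - t) ^ Suc b) - real (Suc b) * (t ^ Suc a * (1 - t) ^ b)) (at t within {0..1})"
      by (simp only: has_real_derivative_iff_has_vector_derivative)
  qed simp
  from has_integral_add[OF this has_integral_mult_right[OF Suc.IH[of "Suc a"], of "real (Suc b)"]]
  have *: "((\<lambda>t. real (Suc a) * (t ^ a * (1 - t) ^ Suc b)) has_integral
      real (Suc b) * (fact (Suc a) * fact b / fact (Suc a + b + 1))) {0..1}"
    by simp
  have "((\<lambda>t. 1 / real (Suc a) * (real (Suc a) * (t ^ a * (1 - t) ^ Suc b))) has_integral
      1 / real (Suc a) * (real (Suc b) * (fact (Suc a) * fact b / fact (Suc a + b + 1)))) {0..1}"
    by (rule has_integral_mult_right[OF *])
  also have "(\<lambda>t. 1 / real (Suc a) * (real (Suc a) * (t ^ a * (1 - t) ^ Suc b))) = (\<lambda>t. t ^ a * (1 - t) ^ Suc b)"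
    by (simp del: of_nat_Suc power_Suc)
  also have "1 / real (Suc a) * (real (Suc b) * (fact (Suc a) * fact b / fact (Suc a + b + 1))) =
      fact a * fact (Suc b) / fact (a + Suc b + 1)"
    by (simp add: fact_Suc[of a] fact_Suc[of b] mult_ac del: of_nat_Suc fact_Suc)
  finally show ?case .
qed

lemma norm_beta_laplace_imaginary_le:
  "cmod (beta_laplace a b (\<i> * of_real x)) \<le> fact a * fact b / fact (a + b + 1)"
  unfolding beta_laplace_def
proof (rule integral_norm_bound_integral[OF beta_laplace_integrable, THEN order.trans])
  show "(\<lambda>t. t ^ a * (1 - t) ^ b) integrable_on {0..1::real}"
    using beta_integral by blast
  show "integral {0..1} (\<lambda>t::real. t ^ a * (1 - t) ^ b) \<le> fact a * fact b / fact (a + b + 1)"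
    using integral_unique[OF beta_integral] by simp
  fix t :: real assume "t \<in> {0..1}"
  moreover have "cmod (1 - of_real t) = \<bar>1 - t\<bar>"
    by (metis norm_of_real of_real_1 of_real_diff)
  ultimately show "cmod (of_real t ^ a * (1 - of_real t) ^ b * exp (- (of_real t * (\<i> * of_real x)))) \<le> t ^ a * (1 - t) ^ b"
    by (simp add: norm_mult norm_power)
qed

text \<open>
  The imaginary part of the exponential is \<open>-sin (t x)\<close>, and \<open>|sin (t x)| \<le> t x\<close> moves one factor \<open>t\<close>
  into the weight.
\<close>

lemma Im_beta_laplace_imaginary_le:
  assumes "0 \<le> x"
  shows "\<bar>Im (beta_laplace a b (\<i> * of_real x))\<bar> \<le> x * (fact (a + 1) * fact b / fact (a + b + 2))"
proof -
  let ?f = "\<lambda>t. of_real t ^ a * (1 - of_real t) ^ b * exp (- (of_real t * (\<i> * of_real x))) :: complex"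
  have "((\<lambda>t. Im (?f t)) has_integral Im (beta_laplace a b (\<i> * of_real x))) {0..1}"
    using has_integral_linear[OF integrable_integral[OF beta_laplace_integrable] bounded_linear_Im]
    unfolding beta_laplace_def o_def .
  moreover have "((\<lambda>t. x * (t ^ (a + 1) * (1 - t) ^ b)) has_integral
      x * (fact (a + 1) * fact b / fact (a + b + 2))) {0..1}"
    using has_integral_mult_right[OF beta_integral[of "a + 1" b], of x] by simp
  moreover have "norm (Im (?f t)) \<le> x * (t ^ (a + 1) * (1 - t) ^ b)" if "t \<in> {0..1}" for t
  proof -
    have "Im (?f t) = t ^ a * (1 - t) ^ b * - sin (t * x)"
    proof -
      have "?f t = of_real (t ^ a * (1 - t) ^ b) * cis (- (t * x))"
        by (simp add: cis_conv_exp mult_ac)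
      thus ?thesis by (simp del: of_real_mult of_real_power)
    qed
    hence "norm (Im (?f t)) = t ^ a * (1 - t) ^ b * \<bar>sin (t * x)\<bar>"
      using that by (simp add: abs_mult)
    also have "\<dots> \<le> t ^ a * (1 - t) ^ b * (t * x)"
      using that assms abs_sin_x_le_abs_x[of "t * x"] by (intro mult_left_mono) auto
    finally show ?thesis by (simp add: mult_ac)
  qed
  ultimately show ?thesis
    using integral_norm_bound_integral[of "\<lambda>t. Im (?f t)" "{0..1}" "\<lambda>t. x * (t ^ (a + 1) * (1 - t) ^ b)"]
    by (simp only: has_integral_iff real_norm_def)
qed


section \<open>Pade denominators on the imaginary axis\<close>

lemma pochhammer_minus_of_nat:
  assumes "j \<le> a"
  shows "pochhammer (- of_nat a) j = (-1) ^ j * (fact a / fact (a - j) :: complex)"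
proof -
  have "(fact a :: complex) = fact (a - j) * pochhammer (of_nat a - of_nat j + 1) j"
    using pochhammer_product[of "a - j" a "1::complex"] assms
    by (simp add: pochhammer_fact[symmetric] of_nat_diff algebra_simps)
  thus ?thesis
    by (subst pochhammer_minus) (simp add: field_simps)
qed

lemma coeff_kummer_poly_minus:
  assumes "j \<le> a" "a \<le> m"
  shows "coeff (kummer_poly a (- of_nat m)) j = of_nat ((a choose j) * fact (m - j)) / fact m"
  using assms
  by (simp add: coeff_kummer_poly pochhammer_minus_of_nat binomial_fact field_simps)

lemma poly_kummer_poly:
  "poly (kummer_poly a (- of_nat (a + b))) y = scaled_kummer a b y / fact (a + b)"
proof -
  have "degree (kummer_poly a (- of_nat (a + b))) \<le> a"
    by (rule degree_le) (simp add: coeff_kummer_poly)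
  from arg_cong[OF poly_as_sum_of_monoms'[OF this], of "\<lambda>p. poly p y"]
  have "poly (kummer_poly a (- of_nat (a + b))) y =
      (\<Sum>j\<le>a. coeff (kummer_poly a (- of_nat (a + b))) j * y ^ j)"
    by (simp add: poly_sum poly_monom)
  also have "\<dots> = (\<Sum>j\<le>a. of_nat ((a choose j) * fact (a + b - j)) / fact (a + b) * y ^ j)"
    by (intro sum.cong refl, subst coeff_kummer_poly_minus) auto
  finally show ?thesis
    by (simp add: scaled_kummer_def sum_divide_distrib)
qed

text \<open>
  The confluent hypergeometric equation \<open>y K'' + (-m - y) K' + n K = 0\<close>.
\<close>

lemma kummer_poly_ode:
  fixes n m :: nat
  assumes "n \<le> m"
  defines "K \<equiv> kummer_poly n (- of_nat m)"
  shows "[:0, 1:] * pderiv (pderiv K) = [:of_nat m, 1:] * pderiv K - smult (of_nat n) K"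
proof (rule poly_eqI)
  have rec: "of_nat (Suc j) * (of_nat m - of_nat j) * coeff K (Suc j) = (of_nat n - of_nat j) * coeff K j" for j
  proof (cases "j < n")
    case True
    have ne: "of_nat j - of_nat m \<noteq> (0::complex)" "pochhammer (- of_nat m) j \<noteq> (0::complex)"
      using True assms by (auto simp: pochhammer_of_nat_eq_0_iff)
    hence "of_nat (Suc j) * (of_nat j - of_nat m) * coeff K (Suc j) = (of_nat j - of_nat n) * coeff K j"
      using True unfolding K_def coeff_kummer_poly
      by (simp add: pochhammer_Suc divide_simps del: of_nat_Suc)
    thus ?thesis by (simp add: algebra_simps)
  qed (auto simp: K_def coeff_kummer_poly)
  fix j
  show "coeff ([:0, 1:] * pderiv (pderiv K)) j = coeff ([:of_nat m, 1:] * pderiv K - smult (of_nat n) K) j"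
  proof (cases j)
    case 0
    thus ?thesis using rec[of 0] by (simp add: coeff_pderiv)
  next
    case (Suc i)
    thus ?thesis using rec[of j] by (simp add: coeff_pderiv algebra_simps)
  qed
qed

text \<open>
  Write \<open>M(y) = K(-y)\<close>, \<open>Q = K' M - K M'\<close> and \<open>S = K' M'\<close>. The equations of \<open>K\<close> and \<open>M\<close> express \<open>y W''\<close>,
  \<open>y Q'\<close> and \<open>y S'\<close> linearly in \<open>W\<close>, \<open>W'\<close>, \<open>Q\<close>, \<open>S\<close>. Comparing coefficients, those of \<open>Q\<close> and \<open>S\<close> of degree
  \<open>2 k\<close> are multiples of that of \<open>W\<close>, and eliminating them leaves a two-term recurrence for \<open>W\<close> with a
  negative factor for \<open>k < n\<close>; here \<open>2 n \<le> m\<close> keeps all denominators positive. For \<open>k \<ge> n\<close> the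
  degree is exhausted.
\<close>

lemma kummer_poly_product_coeff:
  fixes n m :: nat
  assumes nm: "2 * n \<le> m"
  defines "K \<equiv> kummer_poly n (- of_nat m)"
  defines "W \<equiv> K * pcompose K [:0, -1:]"
  shows "\<exists>r\<ge>0. coeff W (2 * k) = of_real ((-1) ^ k * r)"
proof -
  define M where "M = pcompose K [:0, -1:]"
  have W: "W = K * M" by (simp add: W_def M_def)
  have ode: "[:0, 1:] * pderiv (pderiv K) = [:of_nat m, 1:] * pderiv K - smult (of_nat n) K"
    unfolding K_def using nm by (intro kummer_poly_ode) auto
  have M': "pcompose (pderiv K) [:0, -1:] = - pderiv M"
    by (simp add: M_def pderiv_pcompose pderiv_pCons)
  have M'': "pcompose (pderiv (pderiv K)) [:0, -1:] = pderiv (pderiv M)"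
    using arg_cong[OF M', of pderiv] by (simp add: pderiv_pcompose pderiv_pCons pderiv_minus)
  have ode': "[:0, 1:] * pderiv (pderiv M) = [:of_nat m, -1:] * pderiv M + smult (of_nat n) M"
    using arg_cong[OF ode, of "\<lambda>p. - pcompose p [:0, -1:]"]
    by (simp add: pcompose_mult pcompose_add pcompose_diff pcompose_smult pcompose_pCons M' M'' M_def[symmetric])
  define Q where "Q = pderiv K * M - K * pderiv M"
  define S where "S = pderiv K * pderiv M"
  have dK: "degree K \<le> n"
    unfolding K_def by (rule degree_le) (simp add: coeff_kummer_poly)
  let ?X = "[:0, 1:] :: complex poly" and ?m = "[:of_nat m:] :: complex poly" and ?n = "[:of_nat n:] :: complex poly"
  have ode1: "?X * pderiv (pderiv K) = ?m * pderiv K + ?X * pderiv K - ?n * K"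
    and ode2: "?X * pderiv (pderiv M) = ?m * pderiv M - ?X * pderiv M + ?n * M"
    unfolding ode ode' by simp_all
  have eqW: "?X * pderiv (pderiv W) = ?m * pderiv W + ?X * Q + (?X * S + ?X * S)"
  proof -
    have "?X * pderiv (pderiv W) = (?X * pderiv (pderiv K)) * M + 2 * (?X * S) + K * (?X * pderiv (pderiv M))"
      unfolding W S_def by (simp only: pderiv_mult pderiv_add) algebra
    also have "\<dots> = ?m * pderiv W + ?X * Q + (?X * S + ?X * S)"
      unfolding ode1 ode2 W Q_def pderiv_mult by algebra
    finally show ?thesis .
  qed
  have eqQ: "?X * pderiv Q = ?m * Q + ?X * pderiv W - (?n * W + ?n * W)"
  proof -
    have "?X * pderiv Q = (?X * pderiv (pderiv K)) * M - K * (?X * pderiv (pderiv M))"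
      unfolding Q_def by (simp only: pderiv_mult pderiv_diff) algebra
    also have "\<dots> = ?m * Q + ?X * pderiv W - (?n * W + ?n * W)"
      unfolding ode1 ode2 W Q_def pderiv_mult by algebra
    finally show ?thesis .
  qed
  have eqS: "?X * pderiv S = ?m * S + ?m * S + ?n * Q"
  proof -
    have "?X * pderiv S = (?X * pderiv (pderiv K)) * pderiv M + pderiv K * (?X * pderiv (pderiv M))"
      unfolding S_def by (simp only: pderiv_mult) algebra
    also have "\<dots> = ?m * S + ?m * S + ?n * Q"
      unfolding ode1 ode2 S_def Q_def by algebra
    finally show ?thesis .
  qed
  have double: "coeff (p * 2) i = 2 * coeff p i" "coeff (2 * p) i = 2 * coeff p i"
    for p :: "complex poly" and i
    by (simp_all only: mult_2 mult_2_right coeff_add)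
  have W_step: "coeff Q i + 2 * coeff S i =
      (of_nat (i + 1) - of_nat m) * (of_nat (i + 2) * coeff W (i + 2))" for i
  proof -
    have "of_nat (i + 1) * (of_nat (i + 2) * coeff W (i + 2)) =
        of_nat m * (of_nat (i + 2) * coeff W (i + 2)) + (coeff Q i + 2 * coeff S i)"
      using arg_cong[OF eqW, of "\<lambda>p. coeff p (Suc i)"]
      by (simp add: coeff_pderiv double)
    thus ?thesis by (simp only: left_diff_distrib) simp
  qed
  show ?thesis
  proof (induction k)
    case 0
    show ?case
      by (intro exI[of _ 1]) (simp add: W M_def K_def coeff_mult_0 coeff_kummer_poly pcompose_coeff_0 poly_0_coeff_0)
  next
    case (Suc k)
    then obtain r where r: "r \<ge> 0" "coeff W (2 * k) = of_real ((-1) ^ k * r)"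
      by blast
    show ?case
    proof (cases "k < n")
      case False
      have "degree M \<le> n"
        using dK by (simp add: M_def degree_pcompose)
      hence "degree W \<le> n + n"
        unfolding W using dK by (intro order.trans[OF degree_mult_le] add_mono)
      hence "coeff W (2 * Suc k) = 0"
        using False by (intro coeff_eq_0) simp
      thus ?thesis
        by (intro exI[of _ 0]) simp
    next
      case True
      \<comment> \<open>The factors of the recurrence: \<open>e\<close> and the denominators \<open>d1\<close>, \<open>d2\<close>, \<open>g\<close> are nonnegative for \<open>k < n\<close>.\<close>
      define d1 d2 d3 where d: "d1 = real m - 2 * real k" "d2 = real m - real k" "d3 = real m - 2 * real k - 1"
      define e where "e = 2 * (real n - real k)"
      define g where "g = (2 * real k + 2) * d3"
      have pos: "d1 > 0" "d2 > 0" "e \<ge> 0" "g > 0" "d2 \<ge> real n"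
        using True nm by (auto simp: d e_def g_def intro!: mult_pos_pos)
      have "of_real d1 * coeff Q (2*k) = of_real e * coeff W (2*k)"
        using arg_cong[OF eqQ, of "\<lambda>p. coeff p (2*k)"]
        by (cases k) (simp_all add: d e_def coeff_pderiv double algebra_simps)
      hence "coeff Q (2*k) = of_real (e / d1) * coeff W (2*k)"
        using pos by (simp add: field_simps)
      also define q where "q = e / d1 * ((-1) ^ k * r)"
      have "of_real (e / d1) * coeff W (2*k) = of_real q"
        by (simp add: q_def r)
      finally have Q: "coeff Q (2*k) = of_real q" .
      have "of_real (2 * d2) * coeff S (2*k) + of_nat n * coeff Q (2*k) = 0"
        using arg_cong[OF eqS, of "\<lambda>p. coeff p (2*k)"]
        by (cases k) (simp_all add: d coeff_pderiv double algebra_simps)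
      hence "of_real (2 * d2) * coeff S (2*k) = - (of_nat n * of_real q)"
        unfolding Q by (simp only: eq_neg_iff_add_eq_0)
      hence "coeff S (2*k) = of_real (- real n / (2 * d2) * q)"
        using pos by (simp add: field_simps)
      moreover have "of_real g * coeff W (2 * Suc k) + (coeff Q (2*k) + 2 * coeff S (2*k)) = 0"
        unfolding W_step[of "2*k", simplified] by (simp add: d g_def ring_distribs)
      ultimately have "of_real g * coeff W (2 * Suc k) + of_real (q + 2 * (- real n / (2 * d2) * q)) = 0"
        by (simp add: Q)
      hence "of_real g * coeff W (2 * Suc k) = of_real (- (q + 2 * (- real n / (2 * d2) * q)))"
        by (simp only: eq_neg_iff_add_eq_0 of_real_minus)
      hence "coeff W (2 * Suc k) = of_real (- (q + 2 * (- real n / (2 * d2) * q))) / of_real g"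
        using pos by (simp only: eq_divide_eq mult.commute of_real_eq_0_iff) simp
      also have "\<dots> = of_real ((-1) ^ Suc k * (e / d1 * r * (1 - real n / d2) / g))"
      proof -
        have "- (q + 2 * (- real n / (2 * d2) * q)) / g = (-1) ^ Suc k * (e / d1 * r * (1 - real n / d2) / g)"
          by (simp add: q_def algebra_simps)
        thus ?thesis by (metis of_real_divide)
      qed
      finally have "coeff W (2 * Suc k) = of_real ((-1) ^ Suc k * (e / d1 * r * (1 - real n / d2) / g))" .
      moreover have "e / d1 * r * (1 - real n / d2) / g \<ge> 0"
        using pos r(1) by (intro divide_nonneg_pos mult_nonneg_nonneg) (auto simp: field_simps)
      ultimately show ?thesis by blast
    qed
  qed
qed

text \<open>
  On the imaginary axis \<open>|K(ix)|\<^sup>2 = K(ix) K(-ix)\<close>, because \<open>K\<close> has real coefficients. In this even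
  polynomial the signs \<open>(-1)\<^sup>k\<close> of the coefficients cancel against those of \<open>(ix)\<^sup>2\<^sup>k\<close>, so it is at
  least its constant term.
\<close>

lemma norm_kummer_poly_imaginary_ge_1:
  fixes n m :: nat and x :: real
  assumes nm: "2 * n \<le> m"
  shows "1 \<le> cmod (poly (kummer_poly n (- of_nat m)) (\<i> * of_real x))"
proof -
  define K where "K = kummer_poly n (- of_nat m)"
  define W where "W = K * pcompose K [:0, -1:]"
  have K: "poly K y = scaled_kummer n (m - n) y / fact m" for y
    using poly_kummer_poly[of n "m - n" y] nm unfolding K_def by simp
  have term_nonneg: "0 \<le> Re (coeff W j * (\<i> * of_real x) ^ j)" for j
  proof (cases "even j")
    case True
    then obtain k where j: "j = 2 * k" by blast
    obtain r where r: "r \<ge> 0" "coeff W (2 * k) = of_real ((-1) ^ k * r)"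
      using kummer_poly_product_coeff[OF nm, of k] unfolding W_def K_def by blast
    have "(\<i> * of_real x)\<^sup>2 = of_real (- (x\<^sup>2))"
      by (simp add: power_mult_distrib)
    hence "coeff W j * (\<i> * of_real x) ^ j = of_real (r * ((-1) ^ k * (- (x\<^sup>2)) ^ k))"
      unfolding j r(2) power_mult by simp
    also have "(-1) ^ k * (- (x\<^sup>2)) ^ k = (x\<^sup>2) ^ k"
      by (simp flip: power_mult_distrib)
    finally show ?thesis
      using r(1) by simp
  next
    case False
    have "pcompose W [:0, -1:] = pcompose K [:0, -1:] * pcompose K [:0, 1:]"
      by (simp add: W_def pcompose_mult pcompose_pCons flip: pcompose_assoc)
    hence "pcompose W [:0, -1:] = W"
      by (simp add: W_def mult.commute pcompose_idR)
    hence "coeff W j = (-1) ^ j * coeff W j"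
      by (metis coeff_pcompose_linear)
    thus ?thesis
      using False by simp
  qed
  have "cnj (poly K (\<i> * of_real x)) = poly (pcompose K [:0, -1:]) (\<i> * of_real x)"
    by (simp add: K cnj_scaled_kummer poly_pcompose)
  hence "of_real ((cmod (poly K (\<i> * of_real x)))\<^sup>2) = poly W (\<i> * of_real x)"
    by (simp only: W_def complex_norm_square poly_mult)
  hence "(cmod (poly K (\<i> * of_real x)))\<^sup>2 = Re (poly W (\<i> * of_real x))"
    by (metis Re_complex_of_real)
  also have "\<dots> = (\<Sum>j\<le>degree W. Re (coeff W j * (\<i> * of_real x) ^ j))"
    by (simp add: poly_altdef)
  also have "\<dots> \<ge> Re (coeff W 0 * (\<i> * of_real x) ^ 0)"
    by (rule member_le_sum[of 0 "{..degree W}"]) (simp, rule term_nonneg, simp)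
  also have "coeff W 0 = 1"
    by (simp add: W_def K_def coeff_mult_0 coeff_kummer_poly pcompose_coeff_0 poly_0_coeff_0)
  finally have "1 \<le> (cmod (poly K (\<i> * of_real x)))\<^sup>2" by simp
  thus ?thesis
    unfolding K_def by (intro power2_le_imp_le[of 1]) simp_all
qed


section \<open>Pade approximation of (1 - exp (-y)) / y\<close>

text \<open>
  Through degree \<open>a + b\<close>, the product of \<open>1F1(-a; -a-b; y)\<close> and \<open>exp (-y)\<close> has the coefficients of
  \<open>1F1(-b; -a-b; -y)\<close>. Each coefficient is a Vandermonde convolution.
\<close>

lemma kummer_poly_exp_coeff:
  assumes "l \<le> a + b"
  shows "(\<Sum>j\<le>l. coeff (kummer_poly a (- of_nat (a + b))) j * ((-1) ^ (l - j) / fact (l - j))) =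
    (-1) ^ l * coeff (kummer_poly b (- of_nat (a + b))) l"
proof -
  define m where "m = a + b"
  let ?T = "\<lambda>j. pochhammer (- of_nat l) j * pochhammer (- of_nat a) j /
    (of_nat (fact j) * pochhammer (- of_nat m) j :: complex)"
  have eq: "coeff (kummer_poly a (- of_nat m)) j * ((-1) ^ (l - j) / fact (l - j)) = (-1) ^ l / fact l * ?T j"
    if "j \<le> l" for j
  proof (cases "j \<le> a")
    case True
    have "(-1 :: complex) ^ l = (-1) ^ j * (-1) ^ (l - j)"
      using that by (simp flip: power_add)
    thus ?thesis
      using that True by (simp add: coeff_kummer_poly pochhammer_minus_of_nat[of j l] field_simps)
  next
    case False
    thus ?thesis by (simp add: coeff_kummer_poly pochhammer_of_nat_eq_0_iff)
  qed
  have "(\<Sum>j\<le>l. coeff (kummer_poly a (- of_nat m)) j * ((-1) ^ (l - j) / fact (l - j))) =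
      (-1) ^ l / fact l * (\<Sum>j\<le>l. ?T j)"
    unfolding sum_distrib_left by (intro sum.cong refl eq) auto
  also have "(\<Sum>j\<le>l. ?T j) = (\<Sum>j=0..a. ?T j)"
    by (rule sum.mono_neutral_cong) (auto simp: pochhammer_of_nat_eq_0_iff)
  also have "\<dots> = pochhammer (- of_nat m - - of_nat l) a / pochhammer (- of_nat m) a"
    by (rule Vandermonde_pochhammer) (auto simp: m_def simp flip: of_nat_add)
  also have "- of_nat m - - of_nat l = (- of_nat (m - l) :: complex)"
    using assms by (simp add: m_def of_nat_diff)
  also have "(-1) ^ l / fact l * (pochhammer (- of_nat (m - l)) a / pochhammer (- of_nat m) a) =
      (-1) ^ l * coeff (kummer_poly b (- of_nat m)) l"
  proof (cases "l \<le> b")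
    case True
    hence "a \<le> m - l" "m - l - a = b - l" "a \<le> m" "m - a = b" "b \<le> m" by (auto simp: m_def)
    thus ?thesis
      using True
      by (simp add: pochhammer_minus_of_nat coeff_kummer_poly_minus binomial_fact mult_ac del: of_nat_diff)
  next
    case False
    hence "m - l < a" using assms by (auto simp: m_def)
    hence "pochhammer (- of_nat (m - l) :: complex) a = 0"
      by (simp only: pochhammer_of_nat_eq_0_iff)
    thus ?thesis
      using False by (simp add: coeff_kummer_poly)
  qed
  finally show ?thesis
    by (simp only: m_def)
qed

text \<open>
  The power series \<open>(1 - exp (-y)) / y\<close> is multiplied by \<open>y\<close> and by the denominator, and
  \<open>kummer_poly_exp_coeff\<close> identifies the part containing the exponential. The pairs \<open>(n, n + 1)\<close>
  and \<open>(n + 1, n)\<close> share the lower parameter \<open>-2n - 1\<close>.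
\<close>

lemma pade_num_eq:
  "[:0, 1:] * pade_num n =
     pade_denom n - pcompose (kummer_poly (n + 1) (- of_nat (2 * n + 1))) [:0, -1:]"
proof (rule poly_eqI)
  fix i
  let ?B = "pade_denom n" and ?C = "kummer_poly (n + 1) (- of_nat (2 * n + 1))"
  have B0: "coeff ?B 0 = 1"
    by (simp add: pade_denom_def coeff_kummer_poly)
  have pade: "degree (pade_num n) \<le> n"
    "\<And>k. k \<le> n + n \<Longrightarrow> coeff (pade_num n) k = fps_nth (fps_of_poly ?B * fps_hypergeo [1] [2] (-1)) k"
    using is_pade_approximant_pade_num[of n] is_pade_approximant_alt[of ?B] B0 by auto
  show "coeff ([:0, 1:] * pade_num n) i = coeff (?B - pcompose ?C [:0, -1:]) i"
  proof (cases i)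
    case 0
    thus ?thesis by (simp add: B0 coeff_pcompose_linear coeff_kummer_poly poly_0_coeff_0)
  next
    case (Suc k)
    show ?thesis
    proof (cases "k \<le> 2 * n")
      case True
      have neg: "(-1) ^ (k - j) / fact (Suc (k - j)) = - ((-1) ^ (Suc k - j) / fact (Suc k - j) :: complex)"
        if "j \<le> k" for j
        using that by (simp add: Suc_diff_le del: fact_Suc)
      have "coeff (pade_num n) k = (\<Sum>j=0..k. coeff ?B j * fps_nth (fps_hypergeo [1] [2] (-1)) (k - j))"
        using True by (simp add: pade(2) fps_mult_nth del: fps_hypergeo_nth)
      also have "\<dots> = - (\<Sum>j\<le>k. coeff ?B j * ((-1) ^ (Suc k - j) / fact (Suc k - j)))"
        unfolding sum_negf[symmetric]
        by (intro sum.cong) (auto simp: fps_nth_hypergeo_1_2 neg simp del: fps_hypergeo_nth fact_Suc)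
      also have "\<dots> = coeff ?B (Suc k) -
          (\<Sum>j\<le>Suc k. coeff ?B j * ((-1) ^ (Suc k - j) / fact (Suc k - j)))"
        by simp
      also have "(\<Sum>j\<le>Suc k. coeff ?B j * ((-1) ^ (Suc k - j) / fact (Suc k - j))) = (-1) ^ Suc k * coeff ?C (Suc k)"
        using kummer_poly_exp_coeff[of "Suc k" n "n + 1"] True
        unfolding pade_denom_def by (simp only: mult_2 add.assoc)
      finally show ?thesis
        using Suc by (simp add: coeff_pcompose_linear)
    next
      case False
      hence "coeff (pade_num n) k = 0"
        using pade(1) by (intro coeff_eq_0) simp
      thus ?thesis
        using False Suc by (simp add: coeff_pcompose_linear coeff_kummer_poly pade_denom_def)
    qed
  qed
qed

lemma poly_pade_denom: "poly (pade_denom n) y = scaled_kummer n (n + 1) y / fact (2 * n + 1)"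
  using poly_kummer_poly[of n "n + 1" y]
  by (simp only: pade_denom_def mult_2 add.assoc)

lemma poly_pade_num_mult:
  "y * poly (pade_num n) y = poly (pade_denom n) y - scaled_kummer (n + 1) n (- y) / fact (2 * n + 1)"
proof -
  have "y * poly (pade_num n) y = poly ([:0, 1:] * pade_num n) y"
    by simp
  also have "\<dots> = poly (pade_denom n) y - poly (kummer_poly (n + 1) (- of_nat (2 * n + 1))) (- y)"
    unfolding pade_num_eq by (simp add: poly_pcompose del: of_nat_add of_nat_mult)
  also have "poly (kummer_poly (n + 1) (- of_nat (2 * n + 1))) (- y) = scaled_kummer (n + 1) n (- y) / fact (2 * n + 1)"
  proof -
    have "n + 1 + n = 2 * n + 1" by simp
    thus ?thesis
      using poly_kummer_poly[of "n + 1" n "- y"] by (simp only:)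
  qed
  finally show ?thesis .
qed

lemma poly_pade_num_0: "poly (pade_num n) 0 = 1"
proof -
  have B0: "coeff (pade_denom n) 0 = 1"
    by (simp add: pade_denom_def coeff_kummer_poly)
  have "coeff (pade_num n) 0 = fps_nth (fps_of_poly (pade_denom n) * fps_hypergeo [1] [2] (-1)) 0"
    using is_pade_approximant_pade_num[of n] is_pade_approximant_alt[of "pade_denom n"] B0 by auto
  thus ?thesis
    by (simp add: B0 poly_0_coeff_0)
qed

lemma poly_pade_denom_0: "poly (pade_denom n) 0 = 1"
  by (simp add: pade_denom_def poly_0_coeff_0 coeff_kummer_poly)

text \<open>
  The entire function with Taylor series \<open>1F1(1; 2; -y)\<close>.
\<close>

definition exp_quotient :: "complex \<Rightarrow> complex" where
  "exp_quotient y = (if y = 0 then 1 else (1 - exp (- y)) / y)"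

lemma pade_residual:
  "exp_quotient y * poly (pade_denom n) y - poly (pade_num n) y =
     (-1) ^ (n + 1) * y ^ (2 * n + 1) * beta_laplace n (n + 1) y / fact (2 * n + 1)"
proof (cases "y = 0")
  case True
  thus ?thesis
    by (simp add: exp_quotient_def poly_pade_num_0 poly_pade_denom_0)
next
  case False
  have "y * (exp_quotient y * poly (pade_denom n) y - poly (pade_num n) y) =
      (1 - exp (- y)) * poly (pade_denom n) y - y * poly (pade_num n) y"
    using False by (simp add: exp_quotient_def field_simps)
  also have "\<dots> = (scaled_kummer (n + 1) n (- y) - exp (- y) * scaled_kummer n (n + 1) y) / fact (2 * n + 1)"
    unfolding poly_pade_num_mult poly_pade_denom by (simp add: diff_divide_distrib left_diff_distrib)
  also have "\<dots> = y * ((-1) ^ (n + 1) * y ^ (2 * n + 1) * beta_laplace n (n + 1) y / fact (2 * n + 1))"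
  proof -
    have "n + (n + 1) + 1 = Suc (2 * n + 1)" by simp
    thus ?thesis
      unfolding scaled_kummer_remainder by (simp only: power_Suc) (simp add: mult_ac del: power_Suc fact_Suc)
  qed
  finally show ?thesis
    by (rule mult_left_cancel[THEN iffD1, OF False])
qed


section \<open>Scalar error bounds on the imaginary axis\<close>

lemma alternating_sum_bounds:
  fixes f :: "nat \<Rightarrow> real"
  assumes "\<And>k. 0 \<le> f k" "\<And>k. f (Suc k) \<le> f k"
  shows "0 \<le> (\<Sum>k<N. (-1) ^ k * f k) \<and> (\<Sum>k<N. (-1) ^ k * f k) \<le> f 0"
  using assms
proof (induction N arbitrary: f)
  case (Suc N)
  have "0 \<le> (\<Sum>k<N. (-1) ^ k * f (Suc k)) \<and> (\<Sum>k<N. (-1) ^ k * f (Suc k)) \<le> f (Suc 0)"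
    by (rule Suc.IH) (use Suc.prems in auto)
  moreover have "(\<Sum>k<Suc N. (-1) ^ k * f k) = f 0 - (\<Sum>k<N. (-1) ^ k * f (Suc k))"
    by (subst sum.lessThan_Suc_shift) (simp add: sum_negf)
  ultimately show ?case
    using Suc.prems(2)[of 0] by linarith
qed simp

lemma sum_lessThan_even_odd:
  fixes f :: "nat \<Rightarrow> 'a::comm_monoid_add"
  shows "(\<Sum>j<2 * N. f j) = (\<Sum>k<N. f (2 * k) + f (2 * k + 1))"
  by (induction N) (simp_all add: add_ac)

text \<open>
  Each coefficient of the denominator is at most half the preceding one. So for \<open>x \<le> 2\<close> the terms of
  the imaginary part alternate in sign and decrease, and the first one bounds the sum.
\<close>

lemma Im_pade_denom_imaginary_bounds:
  assumes x: "0 \<le> x" "x \<le> 2"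
  shows "\<bar>Im (poly (pade_denom n) (\<i> * of_real x))\<bar> \<le> real n / real (2 * n + 1) * x"
proof -
  define b where "b = (\<lambda>j. real ((n choose j) * fact (2 * n + 1 - j)) / fact (2 * n + 1))"
  have half: "2 * b (Suc j) \<le> b j" for j
  proof (cases "j < n")
    case True
    hence "2 * n + 1 - j = Suc (2 * n + 1 - Suc j)" by simp
    hence fact_eq: "fact (2 * n + 1 - j) = (2 * n + 1 - j) * (fact (2 * n + 1 - Suc j) :: nat)"
      by (metis fact_Suc of_nat_id)
    have "2 * (n choose Suc j) \<le> 2 * (Suc j * (n choose Suc j))"
      by simp
    also have "Suc j * (n choose Suc j) = (n - j) * (n choose j)"
      by (metis True Suc_diff_Suc binomial_absorb_comp binomial_absorption diff_Suc_1 less_imp_Suc_add mult.commute)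
    also have "2 * ((n - j) * (n choose j)) \<le> (n choose j) * (2 * n + 1 - j)"
    proof -
      have "2 * (n - j) \<le> 2 * n + 1 - j" using True by simp
      from mult_left_mono[OF this, of "n choose j"] show ?thesis by (simp add: mult_ac)
    qed
    finally have "2 * (n choose Suc j) * fact (2 * n + 1 - Suc j) \<le> (n choose j) * fact (2 * n + 1 - j)"
      unfolding fact_eq by (metis mult.assoc mult_le_mono1)
    hence "real (2 * (n choose Suc j) * fact (2 * n + 1 - Suc j)) \<le> real ((n choose j) * fact (2 * n + 1 - j))"
      by (rule of_nat_mono)
    thus ?thesis
      unfolding b_def by (simp add: divide_right_mono del: fact_Suc of_nat_fact)
  next
    case False
    thus ?thesis by (simp add: b_def binomial_eq_0)
  qed
  have b_nonneg: "0 \<le> b j" for j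
    by (simp add: b_def)
  define f where "f = (\<lambda>k. b (2 * k + 1) * x ^ (2 * k + 1))"
  have f_decr: "f (Suc k) \<le> f k" for k
  proof -
    have "b (2 * k + 3) * x\<^sup>2 \<le> b (2 * k + 3) * 4"
      using x b_nonneg power_mono[of x 2 2] by (intro mult_left_mono) auto
    also have "\<dots> \<le> b (2 * k + 1)"
      using half[of "2 * k + 1"] half[of "2 * k + 2"] by (simp add: numeral_3_eq_3)
    finally have "b (2 * k + 3) * x\<^sup>2 * x ^ (2 * k + 1) \<le> b (2 * k + 1) * x ^ (2 * k + 1)"
      using x by (intro mult_right_mono) auto
    thus ?thesis
      by (simp add: f_def power2_eq_square numeral_3_eq_3 mult_ac)
  qed
  have "poly (pade_denom n) (\<i> * of_real x) = (\<Sum>j\<le>n. of_real (b j) * (\<i> * of_real x) ^ j)"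
  proof -
    have "n + (n + 1) = 2 * n + 1" by simp
    thus ?thesis
      by (simp only: poly_pade_denom scaled_kummer_def b_def sum_divide_distrib) (simp del: fact_Suc)
  qed
  \<comment> \<open>The added coefficients vanish; they make the number of terms even.\<close>
  also have "\<dots> = (\<Sum>j<2 * (n + 1). of_real (b j) * (\<i> * of_real x) ^ j)"
    by (rule sum.mono_neutral_left) (auto simp: b_def)
  also have "\<dots> = (\<Sum>k<n + 1. of_real (b (2 * k)) * (\<i> * of_real x) ^ (2 * k) +
      of_real (b (2 * k + 1)) * (\<i> * of_real x) ^ (2 * k + 1))"
    by (rule sum_lessThan_even_odd)
  also have "\<dots> = (\<Sum>k<n + 1. of_real (b (2 * k) * (-1) ^ k * x ^ (2 * k)) + \<i> * of_real ((-1) ^ k * f k))"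
  proof (intro sum.cong refl)
    fix k
    have "(\<i> * of_real x)\<^sup>2 = of_real (- (x\<^sup>2))"
      by (simp add: power_mult_distrib)
    hence "(\<i> * of_real x) ^ (2 * k) = of_real ((-1) ^ k * x ^ (2 * k))"
      unfolding power_mult by (simp add: power_minus[of "(of_real x)\<^sup>2"])
    thus "of_real (b (2 * k)) * (\<i> * of_real x) ^ (2 * k) + of_real (b (2 * k + 1)) * (\<i> * of_real x) ^ (2 * k + 1) =
        of_real (b (2 * k) * (-1) ^ k * x ^ (2 * k)) + \<i> * of_real ((-1) ^ k * f k)"
      by (simp add: f_def mult_ac)
  qed
  finally have "Im (poly (pade_denom n) (\<i> * of_real x)) = (\<Sum>k<n + 1. (-1) ^ k * f k)"
    by simp
  moreover have "0 \<le> f k" for k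
    using x b_nonneg by (simp add: f_def)
  moreover have "f 0 = real n / real (2 * n + 1) * x"
    by (simp add: f_def b_def)
  ultimately show ?thesis
    using alternating_sum_bounds[of f "n + 1"] f_decr by simp
qed

lemma norm_pade_denom_imaginary_ge_1: "1 \<le> cmod (poly (pade_denom n) (\<i> * of_real x))"
  unfolding pade_denom_def by (rule norm_kummer_poly_imaginary_ge_1) simp

lemma pade_error:
  "exp_quotient (\<i> * of_real x) - poly (pade_num n) (\<i> * of_real x) / poly (pade_denom n) (\<i> * of_real x) =
     - \<i> * of_real (x ^ (2 * n + 1) / fact (2 * n + 1)) * beta_laplace n (n + 1) (\<i> * of_real x) /
       poly (pade_denom n) (\<i> * of_real x)"
proof -
  let ?B = "poly (pade_denom n) (\<i> * of_real x)"
  have "?B \<noteq> 0"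
    using norm_pade_denom_imaginary_ge_1[of n x] by auto
  hence "exp_quotient (\<i> * of_real x) - poly (pade_num n) (\<i> * of_real x) / ?B =
      (exp_quotient (\<i> * of_real x) * ?B - poly (pade_num n) (\<i> * of_real x)) / ?B"
    by (simp add: field_simps)
  also have "(\<i> * of_real x) ^ (2 * n + 1) = (-1) ^ n * \<i> * of_real (x ^ (2 * n + 1))"
    by (simp add: power_mult_distrib power_mult power_minus[of "(complex_of_real x)\<^sup>2"])
  hence "(-1) ^ (n + 1) * (\<i> * of_real x) ^ (2 * n + 1) = - \<i> * of_real (x ^ (2 * n + 1))"
    by (simp only:) (cases "even n"; simp)
  ultimately show ?thesis
    unfolding pade_residual by simp
qed

lemma norm_pade_error_le:
  assumes "0 \<le> x"
  shows "cmod (exp_quotient (\<i> * of_real x) - poly (pade_num n) (\<i> * of_real x) / poly (pade_denom n) (\<i> * of_real x))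
    \<le> (fact n / fact (2 * n + 1))\<^sup>2 / 2 * x ^ (2 * n + 1)"
proof -
  let ?I = "beta_laplace n (n + 1) (\<i> * of_real x)" and ?B = "poly (pade_denom n) (\<i> * of_real x)"
  have "cmod ?I / cmod ?B \<le> cmod ?I"
    using norm_pade_denom_imaginary_ge_1[of n x] divide_left_mono[of 1 "cmod ?B" "cmod ?I"] by force
  also have "\<dots> \<le> fact n * fact (n + 1) / fact (n + (n + 1) + 1)"
    by (rule norm_beta_laplace_imaginary_le)
  also have "\<dots> = (fact n)\<^sup>2 / (2 * fact (2 * n + 1))"
  proof -
    define M where "M = real (n + 1)"
    have "n + (n + 1) + 1 = Suc (2 * n + 1)" by simp
    hence "fact (n + (n + 1) + 1) = 2 * M * fact (2 * n + 1)"
      by (simp only: fact_Suc[of "2 * n + 1"]) (simp add: M_def del: fact_Suc)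
    moreover have "fact (n + 1) = M * fact n"
      by (simp add: M_def)
    moreover have "M \<noteq> 0"
      by (simp add: M_def)
    ultimately show ?thesis
      by (simp only: power2_eq_square) (simp del: fact_Suc)
  qed
  finally have "x ^ (2 * n + 1) / fact (2 * n + 1) * (cmod ?I / cmod ?B) \<le>
      x ^ (2 * n + 1) / fact (2 * n + 1) * ((fact n)\<^sup>2 / (2 * fact (2 * n + 1)))"
    using assms by (intro mult_left_mono) auto
  also have "\<dots> = (fact n / fact (2 * n + 1))\<^sup>2 / 2 * x ^ (2 * n + 1)"
    by (simp add: power2_eq_square mult_ac del: fact_Suc)
  finally show ?thesis
    using assms unfolding pade_error by (simp add: norm_mult norm_divide norm_power del: fact_Suc power_Suc)
qed


text \<open>
  A first-order bound for the sine of a difference of arguments that needs no branch of the argument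
  function.
\<close>

lemma abs_Im_divide_le:
  assumes "1 \<le> cmod w"
  shows "\<bar>Im (z / w)\<bar> \<le> \<bar>Im z\<bar> + cmod z * \<bar>Im w\<bar>"
proof -
  have w2: "1 \<le> (cmod w)\<^sup>2" "cmod w \<le> (cmod w)\<^sup>2"
    using one_le_power[OF assms, of 2] mult_left_mono[OF assms, of "cmod w"]
    by (simp_all add: power2_eq_square)
  have "\<bar>Im z * Re w - Re z * Im w\<bar> \<le> \<bar>Im z\<bar> * \<bar>Re w\<bar> + \<bar>Re z\<bar> * \<bar>Im w\<bar>"
    by (metis abs_mult abs_triangle_ineq4)
  also have "\<dots> \<le> \<bar>Im z\<bar> * (cmod w)\<^sup>2 + (cmod z * \<bar>Im w\<bar>) * (cmod w)\<^sup>2"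
  proof (intro add_mono)
    show "\<bar>Im z\<bar> * \<bar>Re w\<bar> \<le> \<bar>Im z\<bar> * (cmod w)\<^sup>2"
      using abs_Re_le_cmod[of w] w2(2) by (intro mult_left_mono) auto
    have "\<bar>Re z\<bar> * \<bar>Im w\<bar> \<le> cmod z * \<bar>Im w\<bar>"
      by (intro mult_right_mono abs_Re_le_cmod) auto
    also have "\<dots> \<le> (cmod z * \<bar>Im w\<bar>) * (cmod w)\<^sup>2"
      using mult_left_mono[OF w2(1), of "cmod z * \<bar>Im w\<bar>"] by simp
    finally show "\<bar>Re z\<bar> * \<bar>Im w\<bar> \<le> (cmod z * \<bar>Im w\<bar>) * (cmod w)\<^sup>2" .
  qed
  finally have "\<bar>Im z * Re w - Re z * Im w\<bar> \<le> (\<bar>Im z\<bar> + cmod z * \<bar>Im w\<bar>) * (cmod w)\<^sup>2"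
    by (simp only: ring_distribs)
  moreover have "0 < (cmod w)\<^sup>2"
    using w2 by linarith
  ultimately show ?thesis
    by (simp add: Im_divide abs_divide divide_le_eq flip: cmod_power2)
qed

text \<open>
  By \<open>pade_error\<close> the real part of the error is a positive factor times the imaginary part of the
  quotient of integral and denominator. Both imaginary parts are \<open>O(x)\<close> for \<open>x \<le> 2\<close>. For \<open>x > 2\<close> the
  modulus of the error is small enough, since \<open>(2 n + 3) / (2 n + 2) < 2\<close>.
\<close>

lemma Re_pade_error_le:
  assumes x: "0 \<le> x"
  shows "\<bar>Re (exp_quotient (\<i> * of_real x) - poly (pade_num n) (\<i> * of_real x) / poly (pade_denom n) (\<i> * of_real x))\<bar>
    \<le> real (n + 1) / real (2 * n + 3) * (fact n / fact (2 * n + 1))\<^sup>2 * x ^ (2 * n + 2)" (is "\<bar>Re ?E\<bar> \<le> _")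
proof (cases "x \<le> 2")
  case False
  have "\<bar>Re ?E\<bar> \<le> cmod ?E"
    by (rule abs_Re_le_cmod)
  also have "\<dots> \<le> (fact n / fact (2 * n + 1))\<^sup>2 / 2 * x ^ (2 * n + 1)"
    by (rule norm_pade_error_le[OF x])
  also have "\<dots> = (fact n / fact (2 * n + 1))\<^sup>2 * x ^ (2 * n + 1) * (1 / 2)"
    by simp
  also have "\<dots> \<le> (fact n / fact (2 * n + 1))\<^sup>2 * x ^ (2 * n + 1) * (real (n + 1) / real (2 * n + 3) * x)"
  proof (rule mult_left_mono)
    have "real (2 * n + 3) \<le> real (n + 1) * 2 * 2"
      by simp
    also have "\<dots> \<le> real (n + 1) * 2 * x"
      using False by (intro mult_left_mono) auto
    finally show "1 / 2 \<le> real (n + 1) / real (2 * n + 3) * x"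
      by (simp add: field_simps del: of_nat_add of_nat_mult)
  qed (use x in simp)
  finally show ?thesis
    by (simp add: mult_ac del: fact_Suc of_nat_Suc)
next
  case True
  let ?I = "beta_laplace n (n + 1) (\<i> * of_real x)" and ?B = "poly (pade_denom n) (\<i> * of_real x)"
  define c where "c = (fact n / fact (2 * n + 1) :: real)"
  define D where "D = x ^ (2 * n + 1) / fact (2 * n + 1)"
  have D: "0 \<le> D"
    using x by (simp add: D_def)
  have fact1: "fact (n + 1) = real (n + 1) * fact n"
    by simp
  have fact2: "fact (2 * n + 2) = 2 * real (n + 1) * fact (2 * n + 1)"
  proof -
    have "2 * n + 2 = Suc (2 * n + 1)" by simp
    thus ?thesis by (simp only: fact_Suc) simp
  qed
  have fact3: "fact (2 * n + 3) = real (2 * n + 3) * (2 * real (n + 1) * fact (2 * n + 1))"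
  proof -
    have "2 * n + 3 = Suc (2 * n + 2)" by simp
    thus ?thesis by (simp only: fact_Suc fact2)
  qed
  have "?E = - \<i> * of_real D * (?I / ?B)"
    unfolding pade_error D_def by simp
  moreover have "Re (- \<i> * of_real D * z) = D * Im z" for z
    by simp
  ultimately have "\<bar>Re ?E\<bar> = D * \<bar>Im (?I / ?B)\<bar>"
    using D by (simp only: abs_mult abs_of_nonneg)
  also have "\<bar>Im (?I / ?B)\<bar> \<le> \<bar>Im ?I\<bar> + cmod ?I * \<bar>Im ?B\<bar>"
    by (rule abs_Im_divide_le[OF norm_pade_denom_imaginary_ge_1])
  also have "\<dots> \<le> x * (fact (n + 1) * fact (n + 1) / fact (n + (n + 1) + 2)) +
      fact n * fact (n + 1) / fact (n + (n + 1) + 1) * (real n / real (2 * n + 1) * x)"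
    using x True
    by (intro add_mono mult_mono Im_beta_laplace_imaginary_le norm_beta_laplace_imaginary_le
        Im_pade_denom_imaginary_bounds) auto
  also have "n + (n + 1) + 2 = 2 * n + 3" by simp
  also have "n + (n + 1) + 1 = 2 * n + 2" by simp
  also have "x * (fact (n + 1) * fact (n + 1) / fact (2 * n + 3)) +
      fact n * fact (n + 1) / fact (2 * n + 2) * (real n / real (2 * n + 1) * x) =
      (real (n + 1) / real (2 * n + 3) + real n / real (2 * n + 1)) / 2 * (x * fact n * c)"
    unfolding fact1 fact2 fact3 c_def
    by (simp add: divide_simps del: fact_Suc of_nat_Suc of_nat_add of_nat_mult)
       (simp add: algebra_simps del: fact_Suc)
  also have "\<dots> \<le> real (n + 1) / real (2 * n + 3) * (x * fact n * c)"
  proof (rule mult_right_mono)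
    \<comment> \<open>The difference of the two sides is \<open>1\<close>.\<close>
    have "real n * real (2 * n + 3) \<le> real (n + 1) * real (2 * n + 1)"
      by (simp add: algebra_simps)
    hence "real n / real (2 * n + 1) \<le> real (n + 1) / real (2 * n + 3)"
      by (simp add: divide_simps mult_ac del: of_nat_add of_nat_mult)
    moreover have "(p + q) / 2 \<le> p" if "q \<le> p" for p q :: real
      using that by simp
    ultimately show "(real (n + 1) / real (2 * n + 3) + real n / real (2 * n + 1)) / 2 \<le> real (n + 1) / real (2 * n + 3)"
      by blast
  qed (use x in \<open>simp add: c_def\<close>)
  finally have "\<bar>Re ?E\<bar> \<le> D * (real (n + 1) / real (2 * n + 3) * (x * fact n * c))"
    using D by (simp add: mult_left_mono)
  also have "\<dots> = real (n + 1) / real (2 * n + 3) * c\<^sup>2 * x ^ (2 * n + 2)"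
    unfolding D_def c_def by (simp add: power2_eq_square mult_ac del: fact_Suc of_nat_add of_nat_mult)
  finally show ?thesis
    unfolding c_def .
qed

text \<open>
  The diagonal case \<open>a = b = n\<close>, where numerator and denominator are reflections of each other.
\<close>

lemma exp_pade_error_le:
  fixes x :: real and n :: nat
  assumes x: "0 \<le> x"
  defines "N \<equiv> kummer_poly n (- of_nat (2 * n))"
  shows "cmod (exp (- (\<i> * of_real x)) - poly N (- (\<i> * of_real x)) / poly N (\<i> * of_real x))
    \<le> real (2 * n + 1) * (fact n / fact (2 * n + 1))\<^sup>2 * x ^ (2 * n + 1)"
proof -
  let ?y = "\<i> * of_real x" and ?I = "beta_laplace n n (\<i> * of_real x)"
  have N: "poly N y = scaled_kummer n n y / fact (2 * n)" for y
    using poly_kummer_poly[of n n y] by (simp only: N_def mult_2)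
  have ge: "1 \<le> cmod (poly N ?y)"
    unfolding N_def by (rule norm_kummer_poly_imaginary_ge_1) simp
  hence ne: "poly N ?y \<noteq> 0" by auto
  have "exp (- ?y) - poly N (- ?y) / poly N ?y = (exp (- ?y) * poly N ?y - poly N (- ?y)) / poly N ?y"
    using ne by (simp add: field_simps)
  also have "exp (- ?y) * poly N ?y - poly N (- ?y) = - ((scaled_kummer n n (- ?y) - exp (- ?y) * scaled_kummer n n ?y) / fact (2 * n))"
    unfolding N by (simp add: diff_divide_distrib)
  also have "\<dots> = - ((-1) ^ n * ?y ^ (2 * n + 1) * ?I / fact (2 * n))"
    unfolding scaled_kummer_remainder by (simp only: mult_2)
  finally have "cmod (exp (- ?y) - poly N (- ?y) / poly N ?y) = x ^ (2 * n + 1) / fact (2 * n) * (cmod ?I / cmod (poly N ?y))"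
    using x by (simp add: norm_mult norm_divide norm_power del: fact_Suc power_Suc)
  also have "\<dots> \<le> x ^ (2 * n + 1) / fact (2 * n) * (fact n * fact n / fact (2 * n + 1))"
  proof (rule mult_left_mono)
    have "cmod ?I / cmod (poly N ?y) \<le> cmod ?I"
      using ge divide_left_mono[of 1 "cmod (poly N ?y)" "cmod ?I"] by force
    also have "\<dots> \<le> fact n * fact n / fact (2 * n + 1)"
      using norm_beta_laplace_imaginary_le[of n n x] by (simp only: mult_2)
    finally show "cmod ?I / cmod (poly N ?y) \<le> fact n * fact n / fact (2 * n + 1)" .
  qed (use x in simp)
  also have "\<dots> = real (2 * n + 1) * (fact n / fact (2 * n + 1))\<^sup>2 * x ^ (2 * n + 1)"
  proof -
    have "fact (2 * n + 1) = real (2 * n + 1) * fact (2 * n)"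
      by simp
    hence "1 / fact (2 * n) = real (2 * n + 1) / fact (2 * n + 1)"
      by (simp del: fact_Suc of_nat_add of_nat_mult)
    moreover have "x ^ (2 * n + 1) / fact (2 * n) * (fact n * fact n / fact (2 * n + 1)) =
        1 / fact (2 * n) * (x ^ (2 * n + 1) * (fact n * fact n / fact (2 * n + 1)))"
      by simp
    ultimately show ?thesis
      by (simp add: power2_eq_square mult_ac del: fact_Suc of_nat_add of_nat_mult power_Suc)
  qed
  finally show ?thesis .
qed


section \<open>Scalar error bounds for sinc\<close>

lemma gbinomial_minus_of_nat:
  "(- of_nat (Suc m) :: complex) gchoose n = (-1) ^ n * of_nat ((m + n) choose n)"
  using gbinomial_minus[of "of_nat (Suc m) :: complex" n]
  by (simp add: binomial_gbinomial algebra_simps)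

text \<open>
  For the two parameters in use the leading binomial does not vanish, so the Laguerre polynomials are
  nonzero multiples of the Pade denominators.
\<close>

lemma laguerre_poly_eq_exp_pade_denom:
  "laguerre_poly n (- of_nat (2 * n) - 1) =
     smult ((-1) ^ n * of_nat (2 * n choose n)) (kummer_poly n (- of_nat (2 * n)))"
proof -
  have "of_nat n + (- of_nat (2 * n) - 1) = (- of_nat (Suc n) :: complex)"
    by simp
  moreover have "- of_nat (2 * n) - 1 + 1 = (- of_nat (2 * n) :: complex)"
    by simp
  moreover have "n + n = 2 * n"
    by simp
  ultimately show ?thesis
    by (simp only: laguerre_poly_def gbinomial_minus_of_nat)
qed

lemma laguerre_poly_eq_pade_denom:
  "laguerre_poly n (- of_nat (2 * n) - 2) = smult ((-1) ^ n * of_nat ((2 * n + 1) choose n)) (pade_denom n)"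
proof -
  have "of_nat n + (- of_nat (2 * n) - 2) = (- of_nat (Suc (n + 1)) :: complex)"
    by simp
  moreover have "- of_nat (2 * n) - 2 + 1 = (- of_nat (2 * n + 1) :: complex)"
    by simp
  moreover have "n + 1 + n = 2 * n + 1"
    by simp
  ultimately show ?thesis
    by (simp only: laguerre_poly_def gbinomial_minus_of_nat pade_denom_def)
qed

lemma csinc_eq_exp_quotient:
  "csinc z = exp_quotient (2 * \<i> * z) * exp (\<i> * z)"
proof (cases "z = 0")
  case False
  have "(1 - exp (- (2 * \<i> * z))) * exp (\<i> * z) = exp (\<i> * z) - exp (- (\<i> * z))"
    by (simp add: algebra_simps flip: exp_add)
  thus ?thesis
    using False by (simp add: csinc_def exp_quotient_def sin_exp_eq field_simps)
qed (simp add: csinc_def exp_quotient_def)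

lemma csinc_of_real: "csinc (of_real x) = of_real (Re (exp_quotient (\<i> * of_real x)))"
proof (cases "x = 0")
  case False
  have "exp (- (\<i> * of_real x)) = cis (- x)"
    by (simp add: cis_conv_exp)
  thus ?thesis
    using False by (simp add: csinc_def exp_quotient_def Re_divide power2_eq_square flip: sin_of_real)
qed (simp add: csinc_def exp_quotient_def)

lemma cnj_poly_pade_denom: "cnj (poly (pade_denom n) y) = poly (pade_denom n) (cnj y)"
  by (simp add: poly_pade_denom cnj_scaled_kummer)

lemma cnj_poly_pade_num: "cnj (poly (pade_num n) y) = poly (pade_num n) (cnj y)"
proof (cases "y = 0")
  case False
  have "cnj y * cnj (poly (pade_num n) y) = cnj y * poly (pade_num n) (cnj y)"
    unfolding poly_pade_num_mult complex_cnj_mult[symmetric]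
    by (simp add: cnj_poly_pade_denom cnj_scaled_kummer)
  thus ?thesis
    using False by simp
qed (simp add: poly_pade_num_0)

text \<open>
  The approximant of \<open>exp (-ix)\<close> has modulus 1 like the exponential itself, so its inverse is its
  conjugate, and the error of \<open>E\<close> is the imaginary part of the error of the approximant divided by
  \<open>x\<close>.
\<close>

lemma csinc_exp_pade_error_le:
  fixes x :: real and n :: nat
  assumes x: "0 < x"
  defines "L \<equiv> laguerre_poly n (- of_nat (2 * n) - 1)"
  defines "P \<equiv> inverse (poly L (\<i> * of_real x)) * poly L (- \<i> * of_real x)"
  shows "cmod (csinc (of_real x) - - (1 / (2 * \<i>)) * (inverse (of_real x) * (P - inverse P)))
    \<le> real (2 * n + 1) * (fact n / fact (2 * n + 1))\<^sup>2 * x ^ (2 * n)"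
proof -
  define N where "N = kummer_poly n (- of_nat (2 * n))"
  let ?y = "\<i> * of_real x"
  have cnjN: "poly N (- ?y) = cnj (poly N ?y)"
    using poly_kummer_poly[of n n] by (simp add: N_def cnj_scaled_kummer flip: mult_2)
  define c where "c = ((-1) ^ n * of_nat (2 * n choose n) :: complex)"
  have "L = smult c N"
    unfolding L_def c_def N_def by (rule laguerre_poly_eq_exp_pade_denom)
  moreover have "c \<noteq> 0"
    by (simp add: c_def)
  ultimately have "P = poly N (- ?y) / poly N ?y"
    by (simp add: P_def field_simps)
  hence P: "P = cnj (poly N ?y) / poly N ?y" "P = poly N (- ?y) / poly N ?y"
    by (simp_all add: cnjN)
  have invP: "inverse P = cnj P"
    by (simp add: P)
  define D where "D = exp (- ?y) - P"
  have D: "cmod D \<le> real (2 * n + 1) * (fact n / fact (2 * n + 1))\<^sup>2 * x ^ (2 * n + 1)"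
    unfolding D_def P(2) N_def using x by (intro exp_pade_error_le) auto
  have "exp ?y = cnj (exp (- ?y))"
    by (simp add: exp_cnj)
  hence "csinc (of_real x) = - (1 / (2 * \<i>)) * (inverse (of_real x) * (exp (- ?y) - cnj (exp (- ?y))))"
    using x by (simp add: csinc_def sin_exp_eq field_simps)
  hence "csinc (of_real x) - - (1 / (2 * \<i>)) * (inverse (of_real x) * (P - inverse P)) =
      - (1 / (2 * \<i>)) * (inverse (of_real x) * (D - cnj D))"
    unfolding invP D_def by (simp add: algebra_simps)
  also have "cmod \<dots> = cmod (D - cnj D) / (2 * x)"
    using x by (simp add: norm_mult norm_divide norm_inverse field_simps)
  also have "\<dots> \<le> (cmod D + cmod D) / (2 * x)"
    using norm_triangle_ineq4[of D "cnj D"] x by (intro divide_right_mono) auto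
  also have "\<dots> = cmod D / x"
    by simp
  also have "\<dots> \<le> real (2 * n + 1) * (fact n / fact (2 * n + 1))\<^sup>2 * x ^ (2 * n + 1) / x"
    using D x by (intro divide_right_mono) auto
  also have "\<dots> = real (2 * n + 1) * (fact n / fact (2 * n + 1))\<^sup>2 * x ^ (2 * n)"
    using x by simp
  finally show ?thesis .
qed

lemma csinc_pade_error_le:
  fixes x :: real and n :: nat
  assumes x: "0 \<le> x"
  defines "L \<equiv> laguerre_poly n (- of_nat (2 * n) - 2)"
  shows "cmod (csinc (of_real x) - (-1) ^ n * of_nat ((2 * n + 1) choose n) *
      (poly (pade_num n) (2 * \<i> * of_real x) * inverse (poly L (2 * \<i> * of_real x)) * exp (\<i> * of_real x)))
    \<le> 2 ^ (2 * n) * (fact n / fact (2 * n + 1))\<^sup>2 * x ^ (2 * n + 1)"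
proof -
  let ?y = "\<i> * of_real (2 * x)"
  have y: "2 * \<i> * of_real x = ?y"
    by simp
  define c where "c = ((-1) ^ n * of_nat ((2 * n + 1) choose n) :: complex)"
  have "c \<noteq> 0"
    by (simp add: c_def del: binomial_Suc_Suc)
  moreover have L: "L = smult c (pade_denom n)"
    unfolding L_def c_def by (rule laguerre_poly_eq_pade_denom)
  ultimately have "c * (poly (pade_num n) ?y * inverse (poly L ?y) * exp (\<i> * of_real x)) =
      poly (pade_num n) ?y / poly (pade_denom n) ?y * exp (\<i> * of_real x)"
    by (simp add: field_simps)
  hence "csinc (of_real x) - c * (poly (pade_num n) ?y * inverse (poly L ?y) * exp (\<i> * of_real x)) =
      (exp_quotient ?y - poly (pade_num n) ?y / poly (pade_denom n) ?y) * exp (\<i> * of_real x)"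
    unfolding csinc_eq_exp_quotient y by (simp only: left_diff_distrib)
  hence "cmod (csinc (of_real x) - c * (poly (pade_num n) ?y * inverse (poly L ?y) * exp (\<i> * of_real x))) =
      cmod (exp_quotient ?y - poly (pade_num n) ?y / poly (pade_denom n) ?y)"
    by (simp only: norm_mult norm_exp_i_times mult_1_right)
  also have "\<dots> \<le> (fact n / fact (2 * n + 1))\<^sup>2 / 2 * (2 * x) ^ (2 * n + 1)"
    using x by (intro norm_pade_error_le) auto
  also have "\<dots> = 2 ^ (2 * n) * (fact n / fact (2 * n + 1))\<^sup>2 * x ^ (2 * n + 1)"
    by (simp add: power_mult_distrib del: fact_Suc)
  finally show ?thesis
    unfolding y c_def .
qed

text \<open>
  The coefficients are real, so the symmetrization is the mean of \<open>A(ix) / B(ix)\<close> and its conjugate,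
  and sinc is the real part of the function that \<open>A / B\<close> approximates.
\<close>

lemma csinc_sym_pade_error_le:
  fixes x :: real and n :: nat
  assumes x: "0 \<le> x"
  defines "L \<equiv> laguerre_poly n (- of_nat (2 * n) - 2)"
  shows "cmod (csinc (of_real x) - (-1) ^ n / 2 * of_nat ((2 * n + 1) choose n) *
      ((poly (pade_num n) (\<i> * of_real x) * poly L (- \<i> * of_real x) +
        poly (pade_num n) (- \<i> * of_real x) * poly L (\<i> * of_real x)) *
       inverse (poly L (\<i> * of_real x) * poly L (- \<i> * of_real x))))
    \<le> real (n + 1) / real (2 * n + 3) * (fact n / fact (2 * n + 1))\<^sup>2 * x ^ (2 * n + 2)"
proof -
  let ?y = "\<i> * of_real x"
  let ?A = "poly (pade_num n) ?y" and ?B = "poly (pade_denom n) ?y"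
  define c where "c = ((-1) ^ n * of_nat ((2 * n + 1) choose n) :: complex)"
  have c: "c \<noteq> 0"
    by (simp add: c_def del: binomial_Suc_Suc)
  have B: "?B \<noteq> 0"
    using norm_pade_denom_imaginary_ge_1[of n x] by auto
  have L: "poly L y = c * poly (pade_denom n) y" for y
    unfolding L_def c_def laguerre_poly_eq_pade_denom by simp
  have minus: "- \<i> * of_real x = cnj ?y"
    by simp
  have half: "(-1) ^ n / 2 * of_nat ((2 * n + 1) choose n) = c / 2"
    by (simp add: c_def)
  have "c / 2 * ((?A * poly L (cnj ?y) + poly (pade_num n) (cnj ?y) * poly L ?y) *
       inverse (poly L ?y * poly L (cnj ?y))) = (?A / ?B + cnj (?A / ?B)) / 2"
    unfolding L cnj_poly_pade_num[symmetric] cnj_poly_pade_denom[symmetric]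
    using B c by (simp add: field_simps)
  also have "\<dots> = of_real (Re (?A / ?B))"
    by (simp only: complex_add_cnj) simp
  finally have "csinc (of_real x) - c / 2 * ((?A * poly L (cnj ?y) + poly (pade_num n) (cnj ?y) * poly L ?y) *
       inverse (poly L ?y * poly L (cnj ?y))) = of_real (Re (exp_quotient ?y - ?A / ?B))"
    unfolding csinc_of_real by simp
  hence "cmod (csinc (of_real x) - c / 2 * ((?A * poly L (cnj ?y) + poly (pade_num n) (cnj ?y) * poly L ?y) *
       inverse (poly L ?y * poly L (cnj ?y)))) = \<bar>Re (exp_quotient ?y - ?A / ?B)\<bar>"
    by (simp only: norm_of_real)
  also have "\<dots> \<le> real (n + 1) / real (2 * n + 3) * (fact n / fact (2 * n + 1))\<^sup>2 * x ^ (2 * n + 2)"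
    by (rule Re_pade_error_le[OF x])
  finally show ?thesis
    unfolding half minus .
qed


section \<open>From eigenvalues to matrices\<close>

lemma le_double_sup_norm_on:
  assumes "compact S" "continuous_on S f" "s \<in> S" "e \<le> 2 * cmod (f s)"
  shows "e \<le> 2 * sup_norm_on S f"
  using norm_le_sup_norm_on[OF assms(1-3)] assms(4) by linarith

lemma poly_laguerre_poly_imaginary_nonzero:
  "poly (laguerre_poly n (- of_nat (2 * n) - 1)) (\<i> * of_real x) \<noteq> 0"
  "poly (laguerre_poly n (- of_nat (2 * n) - 2)) (\<i> * of_real x) \<noteq> 0"
  using norm_kummer_poly_imaginary_ge_1[of n "2 * n" x] norm_pade_denom_imaginary_ge_1[of n x]
  by (auto simp: laguerre_poly_eq_exp_pade_denom laguerre_poly_eq_pade_denom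
      simp del: of_nat_add of_nat_mult binomial_Suc_Suc)

theorem proposition2:
  fixes A :: "real^'n^'n" and n :: nat and \<Sigma> :: "complex set"
  assumes symmetric: "transpose A = A"
    and psd: "\<forall>v. 0 \<le> v \<bullet> (A *v v)"
    and n: "1 \<le> n"
    and compact: "compact \<Sigma>"
    and W: "field_of_values (complexify A) \<subseteq> \<Sigma>"
  shows
    "(invertible A \<longrightarrow>
        invertible (poly_matrix (laguerre_poly n (- of_nat (2*n) - 1)) (\<i> *\<^sub>M complexify A)) \<and>
        invertible (P_approx n (complexify A)) \<and>
        spectral_norm (matrix_fun csinc (complexify A) - E_approx n (complexify A))
          \<le> 2 * sup_norm_on \<Sigma>
                (\<lambda>z. of_nat (2*n + 1) * (fact n / fact (2*n + 1))\<^sup>2 * z ^ (2*n))) \<and>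
     (invertible (poly_matrix (laguerre_poly n (- of_nat (2*n) - 2)) ((2 * \<i>) *\<^sub>M complexify A)) \<and>
      spectral_norm (matrix_fun csinc (complexify A) - F_approx n (complexify A))
        \<le> 2 * sup_norm_on \<Sigma>
              (\<lambda>z. 2 ^ (2*n) * (fact n / fact (2*n + 1))\<^sup>2 * z ^ (2*n + 1))) \<and>
     (invertible (poly_matrix (laguerre_poly n (- of_nat (2*n) - 2)) (\<i> *\<^sub>M complexify A) **
                  poly_matrix (laguerre_poly n (- of_nat (2*n) - 2)) ((- \<i>) *\<^sub>M complexify A)) \<and>
      spectral_norm (matrix_fun csinc (complexify A) - F_sym_approx n (complexify A))
        \<le> 2 * sup_norm_on \<Sigma>
              (\<lambda>z. of_nat (n + 1) / of_nat (4*n + 6) *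
                   (fact n / fact (2*n + 1))\<^sup>2 * z ^ (2*n + 2)))"
proof -
  obtain U d where U: "orthogonal_matrix U" and eig: "\<And>j. A *v column j U = d j *\<^sub>R column j U"
    using symmetric_matrix_orthogonally_diagonalizable[OF symmetric] by blast
  have norm_col: "norm (column j U) = 1" for j
    using U by (simp add: orthogonal_matrix_orthonormal_columns)
  have d_nonneg: "0 \<le> d j" for j
  proof -
    have "0 \<le> column j U \<bullet> (A *v column j U)"
      using psd by blast
    also have "\<dots> = d j"
      using norm_col[of j] by (simp add: eig norm_eq_1)
    finally show ?thesis .
  qed
  define l where "l = (\<lambda>j. complex_of_real (d j))"
  have A: "complexify A = conj_diag U l"
    unfolding l_def by (rule complexify_eq_conj_diag[OF U eig])
  have l: "l j \<in> \<Sigma>" for j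
    using eigenvalue_in_field_of_values[OF eig norm_col] W by (auto simp: l_def)
  note calc = conj_diag_smult poly_matrix_conj_diag[OF U] conj_diag_mult[OF U] conj_diag_diff
    conj_diag_add matrix_fun_conj_diag[OF U csinc_holomorphic]
    matrix_fun_conj_diag[OF U holomorphic_on_exp]
  let ?L1 = "laguerre_poly n (- of_nat (2*n) - 1)" and ?L2 = "laguerre_poly n (- of_nat (2*n) - 2)"
  have nz: "poly ?L1 (\<i> * l j) \<noteq> 0" "poly ?L1 (- \<i> * l j) \<noteq> 0"
    "poly ?L2 (\<i> * l j) \<noteq> 0" "poly ?L2 (- \<i> * l j) \<noteq> 0" "poly ?L2 (2 * \<i> * l j) \<noteq> 0" for j
    using poly_laguerre_poly_imaginary_nonzero[of n "d j"]
      poly_laguerre_poly_imaginary_nonzero[of n "- d j"]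
      poly_laguerre_poly_imaginary_nonzero[of n "2 * d j"]
    by (simp_all add: l_def mult_ac)
  show ?thesis
    unfolding A
  proof (intro conjI impI)
    show "invertible (poly_matrix ?L1 (\<i> *\<^sub>M conj_diag U l))"
      unfolding calc by (rule conj_diag_inverse(1)[OF U]) (rule nz)
    define P where "P = (\<lambda>j. inverse (poly ?L1 (\<i> * l j)) * poly ?L1 (- \<i> * l j))"
    have P: "P_approx n (conj_diag U l) = conj_diag U P"
      unfolding P_approx_def Let_def calc conj_diag_inverse(2)[OF U nz(1)] P_def ..
    have P_nz: "P j \<noteq> 0" for j
      using nz(1,2) by (simp add: P_def)
    show "invertible (P_approx n (conj_diag U l))"
      unfolding P by (rule conj_diag_inverse(1)[OF U P_nz])
    assume inv: "invertible A"
    have d_pos: "0 < d j" for j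
    proof -
      have "A *v column j U \<noteq> 0"
        using inv norm_col[of j] matrix_left_invertible_ker[of A]
        unfolding invertible_def by (metis norm_zero zero_neq_one)
      hence "d j \<noteq> 0"
        by (auto simp: eig)
      thus ?thesis
        using d_nonneg[of j] by simp
    qed
    hence l_nz: "l j \<noteq> 0" for j
      by (simp add: l_def less_imp_neq[symmetric])
    have E: "E_approx n (conj_diag U l) =
        conj_diag U (\<lambda>j. - (1 / (2 * \<i>)) * (inverse (l j) * (P j - inverse (P j))))"
      unfolding E_approx_def P conj_diag_inverse(2)[OF U l_nz] conj_diag_inverse(2)[OF U P_nz] calc ..
    show "spectral_norm (matrix_fun csinc (conj_diag U l) - E_approx n (conj_diag U l))
        \<le> 2 * sup_norm_on \<Sigma> (\<lambda>z. of_nat (2*n + 1) * (fact n / fact (2*n + 1))\<^sup>2 * z ^ (2*n))"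
      unfolding E calc
    proof (rule spectral_norm_conj_diag_le[OF U], rule le_double_sup_norm_on[OF compact _ l])
      fix j
      have "cmod (csinc (l j) - - (1 / (2 * \<i>)) * (inverse (l j) * (P j - inverse (P j))))
          \<le> real (2 * n + 1) * (fact n / fact (2 * n + 1))\<^sup>2 * d j ^ (2 * n)"
        unfolding P_def l_def by (rule csinc_exp_pade_error_le[OF d_pos])
      also have "\<dots> = cmod (of_nat (2*n + 1) * (fact n / fact (2*n + 1))\<^sup>2 * l j ^ (2*n))"
        using d_nonneg[of j]
        by (simp add: l_def norm_mult norm_power norm_divide norm_fact del: fact_Suc of_nat_Suc of_nat_add of_nat_mult)
      also have "\<dots> \<le> 2 * \<dots>"
        by simp
      finally show "cmod (csinc (l j) - - (1 / (2 * \<i>)) * (inverse (l j) * (P j - inverse (P j))))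
          \<le> 2 * cmod (of_nat (2*n + 1) * (fact n / fact (2*n + 1))\<^sup>2 * l j ^ (2*n))" .
    qed (intro continuous_intros)
  next
    show "invertible (poly_matrix ?L2 ((2 * \<i>) *\<^sub>M conj_diag U l))"
      unfolding calc by (rule conj_diag_inverse(1)[OF U]) (rule nz)
    let ?F = "\<lambda>j. (-1) ^ n * of_nat ((2 * n + 1) choose n) *
      (poly (pade_num n) (2 * \<i> * l j) * inverse (poly ?L2 (2 * \<i> * l j)) * exp (\<i> * l j))"
    have F: "F_approx n (conj_diag U l) = conj_diag U ?F"
      unfolding F_approx_def Let_def calc conj_diag_inverse(2)[OF U nz(5)] ..
    show "spectral_norm (matrix_fun csinc (conj_diag U l) - F_approx n (conj_diag U l))
        \<le> 2 * sup_norm_on \<Sigma> (\<lambda>z. 2 ^ (2*n) * (fact n / fact (2*n + 1))\<^sup>2 * z ^ (2*n + 1))"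
      unfolding F calc
    proof (rule spectral_norm_conj_diag_le[OF U], rule le_double_sup_norm_on[OF compact _ l])
      fix j
      have "cmod (csinc (l j) - ?F j)
          \<le> 2 ^ (2 * n) * (fact n / fact (2 * n + 1))\<^sup>2 * d j ^ (2 * n + 1)"
        unfolding l_def by (rule csinc_pade_error_le[OF d_nonneg])
      also have "\<dots> = cmod (2 ^ (2*n) * (fact n / fact (2*n + 1))\<^sup>2 * l j ^ (2*n + 1))"
        using d_nonneg[of j]
        by (simp add: l_def norm_mult norm_power norm_divide norm_fact del: fact_Suc power_Suc)
      also have "\<dots> \<le> 2 * \<dots>"
        by simp
      finally show "cmod (csinc (l j) - ?F j) \<le> 2 * cmod (2 ^ (2*n) * (fact n / fact (2*n + 1))\<^sup>2 * l j ^ (2*n + 1))" .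
    qed (intro continuous_intros)
  next
    have prod_nz: "poly ?L2 (\<i> * l j) * poly ?L2 (- \<i> * l j) \<noteq> 0" for j
      using nz(3,4) by simp
    show "invertible (poly_matrix ?L2 (\<i> *\<^sub>M conj_diag U l) ** poly_matrix ?L2 ((- \<i>) *\<^sub>M conj_diag U l))"
      unfolding calc by (rule conj_diag_inverse(1)[OF U prod_nz])
    let ?F = "\<lambda>j. (-1) ^ n / 2 * of_nat ((2 * n + 1) choose n) *
      ((poly (pade_num n) (\<i> * l j) * poly ?L2 (- \<i> * l j) +
        poly (pade_num n) (- \<i> * l j) * poly ?L2 (\<i> * l j)) *
       inverse (poly ?L2 (\<i> * l j) * poly ?L2 (- \<i> * l j)))"
    have F: "F_sym_approx n (conj_diag U l) = conj_diag U ?F"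
      unfolding F_sym_approx_def Let_def calc conj_diag_inverse(2)[OF U prod_nz] ..
    show "spectral_norm (matrix_fun csinc (conj_diag U l) - F_sym_approx n (conj_diag U l))
        \<le> 2 * sup_norm_on \<Sigma> (\<lambda>z. of_nat (n + 1) / of_nat (4*n + 6) *
            (fact n / fact (2*n + 1))\<^sup>2 * z ^ (2*n + 2))"
      unfolding F calc
    proof (rule spectral_norm_conj_diag_le[OF U], rule le_double_sup_norm_on[OF compact _ l])
      fix j
      have "cmod (csinc (l j) - ?F j)
          \<le> real (n + 1) / real (2 * n + 3) * (fact n / fact (2 * n + 1))\<^sup>2 * d j ^ (2 * n + 2)"
        unfolding l_def by (rule csinc_sym_pade_error_le[OF d_nonneg])
      also have "\<dots> = 2 * (real (n + 1) / real (4 * n + 6) * (fact n / fact (2 * n + 1))\<^sup>2 * d j ^ (2 * n + 2))"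
      proof -
        have "real (n + 1) / real (2 * n + 3) = 2 * (real (n + 1) / real (4 * n + 6))"
          by (simp add: field_simps)
        thus ?thesis by (simp only: mult.assoc)
      qed
      also have "\<dots> = 2 * cmod (of_nat (n + 1) / of_nat (4*n + 6) *
          (fact n / fact (2*n + 1))\<^sup>2 * l j ^ (2*n + 2))"
        using d_nonneg[of j]
        by (simp add: l_def norm_mult norm_power norm_divide norm_fact
            del: fact_Suc of_nat_Suc of_nat_add of_nat_mult power_Suc)
      finally show "cmod (csinc (l j) - ?F j) \<le> 2 * cmod (of_nat (n + 1) / of_nat (4*n + 6) *
          (fact n / fact (2*n + 1))\<^sup>2 * l j ^ (2*n + 2))" .
    qed (intro continuous_intros)
  qed
qed

end
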